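(* Let $a:\mathbf{R}^N\to(0,\infty)$ be a $C^1$ function and let $H$ be the Friedrichs extension in $L^2(\mathbf{R}^N,\mathrm{d}^Nx)$ of the non-negative symmetric operator $H_0f=-\nabla\cdot(a\nabla f)$, $f\in C_c^\infty(\mathbf{R}^N)$. If there exists a constant $c>0$ such that $0<a(x)\le c$ for all $x\in\mathbf{R}^N$, then for every $\alpha>0$ the operator $A=(H+\alpha I)^{-1}$ satisfies $$\lim_{k\to 0}\|V_kAV_{-k}-A\|=0,$$ so $H$ is affiliated with the C*-algebra $\mathcal{D}$.
   Context: For $k\in\mathbf{R}^N$, $V_k$ is the unitary operator on $L^2(\mathbf{R}^N)$ given by $(V_kf)(x)=\mathrm{e}^{ik\cdot x}f(x)$. $\mathcal{D}$ is the C*-algebra of all bounded operators $A$ on $L^2(\mathbf{R}^N)$ such that $\lim_{k\to0}\|V_kAV_{-k}-A\|=0$. The norm is the operator norm. The Friedrichs extension $H$ is the non-negative self-adjoint operator associated with the closure of the (closable) quadratic form $Q_0(f)=\int_{\mathbf{R}^N}a(x)|\nabla f(x)|^2\,\mathrm{d}^Nx$ defined on $C_c^\infty(\mathbf{R}^N)$. A self-adjoint operator $H$ is affiliated with a C*-algebra $\mathcal{A}$ of operators if $(H-z)^{-1}\in\mathcal{A}$ for some (equivalently all) $z\in\mathbf{C}\setminus\sigma(H)$; for non-negative $H$ this is equivalent to $(H+\alpha I)^{-1}\in\mathcal{A}$ for some (equivalently all) $\alpha>0$. *)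

theory Defs
  imports "HOL-Analysis.Analysis"
begin

section \<open>The complex Hilbert space \<open>L\<^sup>2\<close> of a Euclidean space\<close>

definition square_integrable :: "('a::euclidean_space \<Rightarrow> complex) \<Rightarrow> bool" where
  "square_integrable f \<longleftrightarrow>
     f \<in> borel_measurable lborel \<and> integrable lborel (\<lambda>x. (cmod (f x))\<^sup>2)"

definition l2_rel :: "('a::euclidean_space \<Rightarrow> complex) \<Rightarrow> ('a \<Rightarrow> complex) \<Rightarrow> bool" where
  "l2_rel f g \<longleftrightarrow> square_integrable f \<and> square_integrable g \<and> (AE x in lborel. f x = g x)"

lemma borel_measurable_cnj [measurable (raw)]:
  "f \<in> borel_measurable M \<Longrightarrow> (\<lambda>x. cnj (f x)) \<in> borel_measurable M"
  by (rule borel_measurable_continuous_on[of cnj]) (auto intro!: continuous_intros)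

lemma square_integrable_zero: "square_integrable (\<lambda>x. 0)"
  by (simp add: square_integrable_def)

lemma square_integrable_add:
  assumes "square_integrable f" "square_integrable g"
  shows "square_integrable (\<lambda>x. f x + g x)"
proof -
  have [measurable]: "f \<in> borel_measurable borel" "g \<in> borel_measurable borel"
    using assms by (auto simp: square_integrable_def)
  have "integrable lborel (\<lambda>x. 2 * (cmod (f x))\<^sup>2 + 2 * (cmod (g x))\<^sup>2)"
    using assms by (auto simp: square_integrable_def)
  then have "integrable lborel (\<lambda>x. (cmod (f x + g x))\<^sup>2)"
  proof (rule Bochner_Integration.integrable_bound)
    show "AE x in lborel. norm ((cmod (f x + g x))\<^sup>2)
        \<le> norm (2 * (cmod (f x))\<^sup>2 + 2 * (cmod (g x))\<^sup>2)"
    proof (intro always_eventually allI)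
      fix x
      have "(cmod (f x + g x))\<^sup>2 \<le> (cmod (f x) + cmod (g x))\<^sup>2"
        by (intro power_mono norm_triangle_ineq) auto
      also have "\<dots> \<le> 2 * (cmod (f x))\<^sup>2 + 2 * (cmod (g x))\<^sup>2"
        using sum_squares_bound[of "cmod (f x)" "cmod (g x)"] by (simp add: power2_sum)
      finally show "norm ((cmod (f x + g x))\<^sup>2) \<le> norm (2 * (cmod (f x))\<^sup>2 + 2 * (cmod (g x))\<^sup>2)"
        by simp
    qed
  qed auto
  then show ?thesis by (simp add: square_integrable_def)
qed

lemma square_integrable_mult_left:
  "square_integrable f \<Longrightarrow> square_integrable (\<lambda>x. c * f x)"
  by (auto simp: square_integrable_def norm_mult power_mult_distrib)

lemma square_integrable_minus: "square_integrable f \<Longrightarrow> square_integrable (\<lambda>x. - f x)"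
  by (auto simp: square_integrable_def)

lemma square_integrable_diff:
  "square_integrable f \<Longrightarrow> square_integrable g \<Longrightarrow> square_integrable (\<lambda>x. f x - g x)"
  using square_integrable_add[of f "\<lambda>x. - g x"] square_integrable_minus[of g] by simp

lemma square_integrable_mult_cnj:
  assumes "square_integrable f" "square_integrable g"
  shows "integrable lborel (\<lambda>x. f x * cnj (g x))"
proof -
  have [measurable]: "f \<in> borel_measurable borel" "g \<in> borel_measurable borel"
    using assms by (auto simp: square_integrable_def)
  have "integrable lborel (\<lambda>x. (cmod (f x))\<^sup>2 + (cmod (g x))\<^sup>2)"
    using assms by (auto simp: square_integrable_def)
  then show ?thesis
  proof (rule Bochner_Integration.integrable_bound)
    show "AE x in lborel. norm (f x * cnj (g x)) \<le> norm ((cmod (f x))\<^sup>2 + (cmod (g x))\<^sup>2)"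
    proof (intro always_eventually allI)
      fix x
      have "0 \<le> cmod (f x) * cmod (g x)"
        by simp
      then have "cmod (f x) * cmod (g x) \<le> (cmod (f x))\<^sup>2 + (cmod (g x))\<^sup>2"
        using sum_squares_bound[of "cmod (f x)" "cmod (g x)"] by linarith
      then show "norm (f x * cnj (g x)) \<le> norm ((cmod (f x))\<^sup>2 + (cmod (g x))\<^sup>2)"
        by (simp add: norm_mult)
    qed
  qed auto
qed

quotient_type (overloaded) 'a l2 = "'a::euclidean_space \<Rightarrow> complex" / partial: l2_rel
  by (intro part_equivpI exI[of _ "\<lambda>x. 0"] sympI transpI)
     (auto simp: l2_rel_def square_integrable_zero)

text \<open>The abstraction function \<open>abs_l2\<close> sends a square-integrable function to its
  almost-everywhere class.\<close>

lift_definition cinner :: "'a::euclidean_space l2 \<Rightarrow> 'a l2 \<Rightarrow> complex"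
  is "\<lambda>f g. LINT x|lborel. f x * cnj (g x)"
  unfolding l2_rel_def
  by (intro integral_cong_AE) (auto simp: square_integrable_def)

lift_definition scaleC :: "complex \<Rightarrow> 'a::euclidean_space l2 \<Rightarrow> 'a l2"
  is "\<lambda>c f x. c * f x"
  unfolding l2_rel_def by (auto intro: square_integrable_mult_left)

instantiation l2 :: (euclidean_space) real_vector
begin

lift_definition zero_l2 :: "'a l2" is "\<lambda>x. 0"
  by (simp add: l2_rel_def square_integrable_zero)

lift_definition plus_l2 :: "'a l2 \<Rightarrow> 'a l2 \<Rightarrow> 'a l2" is "\<lambda>f g x. f x + g x"
  unfolding l2_rel_def by (auto intro: square_integrable_add)

lift_definition minus_l2 :: "'a l2 \<Rightarrow> 'a l2 \<Rightarrow> 'a l2" is "\<lambda>f g x. f x - g x"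
  unfolding l2_rel_def by (auto intro: square_integrable_diff)

lift_definition uminus_l2 :: "'a l2 \<Rightarrow> 'a l2" is "\<lambda>f x. - f x"
  unfolding l2_rel_def by (auto intro: square_integrable_minus)

definition scaleR_l2 :: "real \<Rightarrow> 'a l2 \<Rightarrow> 'a l2" where
  "scaleR_l2 r u = scaleC (complex_of_real r) u"

instance
proof
  fix u v w :: "'a l2" and r s :: real
  show "u + v + w = u + (v + w)"
    by transfer (auto simp: l2_rel_def add.assoc intro: square_integrable_add)
  show "u + v = v + u"
    by transfer (auto simp: l2_rel_def add.commute intro: square_integrable_add)
  show "0 + u = u"
    by transfer (auto simp: l2_rel_def)
  show "- u + u = 0"
    by transfer (auto simp: l2_rel_def square_integrable_zero)
  show "u - v = u + - v"
    by transfer (auto simp: l2_rel_def intro: square_integrable_diff)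
  show "r *\<^sub>R (u + v) = r *\<^sub>R u + r *\<^sub>R v"
    unfolding scaleR_l2_def
    by transfer (auto simp: l2_rel_def distrib_left
        intro!: square_integrable_add square_integrable_mult_left)
  show "(r + s) *\<^sub>R u = r *\<^sub>R u + s *\<^sub>R u"
    unfolding scaleR_l2_def
    by transfer (auto simp: l2_rel_def distrib_right
        intro!: square_integrable_add square_integrable_mult_left)
  show "r *\<^sub>R s *\<^sub>R u = (r * s) *\<^sub>R u"
    unfolding scaleR_l2_def
    by transfer (auto simp: l2_rel_def mult.assoc intro!: square_integrable_mult_left)
  show "1 *\<^sub>R u = u"
    unfolding scaleR_l2_def by transfer (auto simp: l2_rel_def)
qed

end

instantiation l2 :: (euclidean_space) real_inner
begin

definition inner_l2 :: "'a l2 \<Rightarrow> 'a l2 \<Rightarrow> real" where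
  "inner_l2 u v = Re (cinner u v)"

definition norm_l2 :: "'a l2 \<Rightarrow> real" where
  "norm_l2 u = sqrt (inner u u)"

definition sgn_l2 :: "'a l2 \<Rightarrow> 'a l2" where
  "sgn_l2 u = u /\<^sub>R norm u"

definition dist_l2 :: "'a l2 \<Rightarrow> 'a l2 \<Rightarrow> real" where
  "dist_l2 u v = norm (u - v)"

definition uniformity_l2 :: "('a l2 \<times> 'a l2) filter" where
  "uniformity_l2 = (INF e\<in>{0 <..}. principal {(u, v). dist u v < e})"

definition open_l2 :: "'a l2 set \<Rightarrow> bool" where
  "open_l2 U \<longleftrightarrow> (\<forall>u\<in>U. eventually (\<lambda>(u', v). u' = u \<longrightarrow> v \<in> U) uniformity)"

instance
proof
  fix u v w :: "'a l2" and r :: real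
  show "dist u v = norm (u - v)" by (fact dist_l2_def)
  show "sgn u = u /\<^sub>R norm u" by (fact sgn_l2_def)
  show "uniformity = (INF e\<in>{0 <..}. principal {(u::'a l2, v). dist u v < e})"
    by (fact uniformity_l2_def)
  show "open U \<longleftrightarrow> (\<forall>u\<in>U. eventually (\<lambda>(u', v). u' = u \<longrightarrow> v \<in> U) uniformity)"
    for U :: "'a l2 set" by (fact open_l2_def)
  show "norm u = sqrt (inner u u)" by (fact norm_l2_def)
  show "inner u v = inner v u"
    unfolding inner_l2_def
  proof transfer
    fix f g :: "'a \<Rightarrow> complex"
    have "Re (LINT x|lborel. g x * cnj (f x)) = Re (LINT x|lborel. cnj (f x * cnj (g x)))"
      by (simp add: mult.commute)
    also have "\<dots> = Re (LINT x|lborel. f x * cnj (g x))"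
      by (subst Bochner_Integration.integral_cnj) simp
    finally show "Re (LINT x|lborel. f x * cnj (g x)) = Re (LINT x|lborel. g x * cnj (f x))" ..
  qed
  show "inner (u + v) w = inner u w + inner v w"
    unfolding inner_l2_def
    by transfer (simp add: l2_rel_def distrib_right square_integrable_mult_cnj)
  show "inner (r *\<^sub>R u) v = r * inner u v"
    unfolding inner_l2_def scaleR_l2_def by transfer (simp add: mult.assoc)
  have *: "Re (LINT x|lborel. f x * cnj (f x)) = (LINT x|lborel. (cmod (f x))\<^sup>2)"
    for f :: "'a \<Rightarrow> complex"
    by (simp flip: complex_norm_square of_real_power)
  show "0 \<le> inner u u"
    unfolding inner_l2_def by transfer (simp add: *)
  show "inner u u = 0 \<longleftrightarrow> u = 0"
    unfolding inner_l2_def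
  proof transfer
    fix f :: "'a \<Rightarrow> complex"
    assume "l2_rel f f"
    then have f: "square_integrable f" by (simp add: l2_rel_def)
    have "(LINT x|lborel. (cmod (f x))\<^sup>2) = 0 \<longleftrightarrow> (AE x in lborel. (cmod (f x))\<^sup>2 = 0)"
      using f by (intro integral_nonneg_eq_0_iff_AE) (auto simp: square_integrable_def)
    then show "Re (LINT x|lborel. f x * cnj (f x)) = 0 \<longleftrightarrow> l2_rel f (\<lambda>x. 0)"
      using f by (simp add: * l2_rel_def square_integrable_zero)
  qed
qed

end

section \<open>Operators on \<open>L\<^sup>2\<close>\<close>

text \<open>Since \<open>norm\<close> on \<open>L\<^sup>2\<close> is the norm of the complex inner product, \<^const>\<open>onorm\<close> is the
  usual operator norm also for complex-linear operators.\<close>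

definition bounded_clinear :: "('a::euclidean_space l2 \<Rightarrow> 'a l2) \<Rightarrow> bool" where
  "bounded_clinear A \<longleftrightarrow> bounded_linear A \<and> (\<forall>c u. A (scaleC c u) = scaleC c (A u))"

text \<open>An unbounded operator is represented by its graph.\<close>

type_synonym 'a l2_graph = "('a l2 \<times> 'a l2) set"

definition adjoint_graph :: "'a::euclidean_space l2_graph \<Rightarrow> 'a l2_graph" where
  "adjoint_graph H = {(v, w). \<forall>(u, h) \<in> H. cinner h v = cinner u w}"

definition self_adjoint :: "'a::euclidean_space l2_graph \<Rightarrow> bool" where
  "self_adjoint H \<longleftrightarrow> closure (Domain H) = UNIV \<and> adjoint_graph H = H"

definition shift_graph :: "'a::euclidean_space l2_graph \<Rightarrow> complex \<Rightarrow> 'a l2_graph" where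
  "shift_graph H z = {(u, h - scaleC z u) |u h. (u, h) \<in> H}"

text \<open>\<open>R\<close> is the everywhere defined bounded inverse of \<open>H - z\<close>.\<close>

definition is_resolvent ::
    "'a::euclidean_space l2_graph \<Rightarrow> complex \<Rightarrow> ('a l2 \<Rightarrow> 'a l2) \<Rightarrow> bool" where
  "is_resolvent H z R \<longleftrightarrow> bounded_clinear R \<and> (shift_graph H z)\<inverse> = {(g, R g) |g. True}"

definition spectrum :: "'a::euclidean_space l2_graph \<Rightarrow> complex set" where
  "spectrum H = {z. \<nexists>R. is_resolvent H z R}"

definition resolvent :: "'a::euclidean_space l2_graph \<Rightarrow> complex \<Rightarrow> 'a l2 \<Rightarrow> 'a l2" where
  "resolvent H z = (THE R. is_resolvent H z R)"

lemma is_resolvent_unique: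
  assumes "is_resolvent H z R" "is_resolvent H z R'"
  shows "R = R'"
proof
  fix g
  have "{(g, R g) |g. True} = {(g, R' g) |g. True}"
    using assms by (auto simp: is_resolvent_def)
  then have "(g, R g) \<in> {(g, R' g) |g. True}" by blast
  then show "R g = R' g" by blast
qed

lemma is_resolvent_resolvent:
  assumes "z \<notin> spectrum H"
  shows "is_resolvent H z (resolvent H z)"
proof -
  obtain R where R: "is_resolvent H z R"
    using assms by (auto simp: spectrum_def)
  then have "resolvent H z = R"
    unfolding resolvent_def by (intro the_equality is_resolvent_unique)
  with R show ?thesis by simp
qed

definition affiliated ::
    "'a::euclidean_space l2_graph \<Rightarrow> ('a l2 \<Rightarrow> 'a l2) set \<Rightarrow> bool" where
  "affiliated H \<A> \<longleftrightarrow> self_adjoint H \<and> (\<exists>z. z \<notin> spectrum H \<and> resolvent H z \<in> \<A>)"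

lift_definition mod_op :: "'a::euclidean_space \<Rightarrow> 'a l2 \<Rightarrow> 'a l2"
  is "\<lambda>k f x. exp (\<i> * complex_of_real (k \<bullet> x)) * f x"
  unfolding l2_rel_def square_integrable_def
  by (auto simp: norm_mult)

lemma mod_op_inverse: "mod_op k (mod_op (- k) u) = u"
proof transfer
  fix k :: 'a and f :: "'a \<Rightarrow> complex"
  have "(\<lambda>x. exp (\<i> * complex_of_real (k \<bullet> x)) * (exp (\<i> * complex_of_real (- k \<bullet> x)) * f x)) = f"
    by (simp flip: mult.assoc exp_add)
  then show "l2_rel f f \<Longrightarrow> l2_rel (\<lambda>x. exp (\<i> * complex_of_real (k \<bullet> x)) *
      (exp (\<i> * complex_of_real (- k \<bullet> x)) * f x)) f"
    by (simp only:)
qed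

lemma mod_op_isometry: "cinner (mod_op k u) (mod_op k v) = cinner u v"
proof transfer
  fix k :: 'a and f g :: "'a \<Rightarrow> complex"
  have *: "exp (\<i> * complex_of_real (k \<bullet> x)) * cnj (exp (\<i> * complex_of_real (k \<bullet> x))) = 1" for x
    by (simp add: exp_cnj flip: exp_add)
  have **: "e * p * cnj (e * q) = (e * cnj e) * (p * cnj q)" for e p q :: complex
    by simp
  show "(LINT x|lborel. exp (\<i> * complex_of_real (k \<bullet> x)) * f x *
      cnj (exp (\<i> * complex_of_real (k \<bullet> x)) * g x)) = (LINT x|lborel. f x * cnj (g x))"
    by (simp only: * ** mult_1)
qed

definition \<D> :: "('a::euclidean_space l2 \<Rightarrow> 'a l2) set" where
  "\<D> = {A. bounded_clinear A \<and>
     ((\<lambda>k. onorm (\<lambda>u. mod_op k (A (mod_op (- k) u)) - A u)) \<longlongrightarrow> 0) (at 0)}"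

section \<open>Differentiability classes and test functions\<close>

definition partial_deriv ::
    "'a::euclidean_space \<Rightarrow> ('a \<Rightarrow> 'b::real_normed_vector) \<Rightarrow> 'a \<Rightarrow> 'b" where
  "partial_deriv b f x = frechet_derivative f (at x) b"

primrec C_k :: "nat \<Rightarrow> ('a::euclidean_space \<Rightarrow> 'b::real_normed_vector) \<Rightarrow> bool" where
  "C_k 0 = (\<lambda>f. continuous_on UNIV f)"
| "C_k (Suc n) = (\<lambda>f. (\<forall>x. f differentiable (at x)) \<and> (\<forall>b\<in>Basis. C_k n (partial_deriv b f)))"

definition test_functions :: "('a::euclidean_space \<Rightarrow> complex) set" where
  "test_functions = {\<phi>. (\<forall>n. C_k n \<phi>) \<and> compact (closure {x. \<phi> x \<noteq> 0})}"

lemma test_functions_square_integrable: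
  assumes "\<phi> \<in> test_functions"
  shows "square_integrable \<phi>"
proof -
  let ?K = "closure {x. \<phi> x \<noteq> 0}"
  from assms have "C_k 0 \<phi>" and K: "compact ?K"
    unfolding test_functions_def by blast+
  then have cont: "continuous_on UNIV \<phi>" by simp
  have "integrable lborel (\<lambda>x. indicator ?K x *\<^sub>R (cmod (\<phi> x))\<^sup>2)"
    using K by (rule borel_integrable_compact)
      (intro continuous_intros continuous_on_subset[OF cont], simp)
  also have "(\<lambda>x. indicator ?K x *\<^sub>R (cmod (\<phi> x))\<^sup>2) = (\<lambda>x. (cmod (\<phi> x))\<^sup>2)"
  proof
    fix x
    show "indicator ?K x *\<^sub>R (cmod (\<phi> x))\<^sup>2 = (cmod (\<phi> x))\<^sup>2"
      using closure_subset[of "{x. \<phi> x \<noteq> 0}"] by (auto simp: indicator_def)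
  qed
  finally show ?thesis
    using cont by (simp add: square_integrable_def borel_measurable_continuous_onI)
qed

section \<open>The quadratic form and the Friedrichs extension\<close>

definition energy :: "('a::euclidean_space \<Rightarrow> real) \<Rightarrow> ('a \<Rightarrow> complex) \<Rightarrow> real" where
  "energy a \<phi> = (LINT x|lborel. a x * (\<Sum>b\<in>Basis. (cmod (partial_deriv b \<phi> x))\<^sup>2))"

definition energy_form ::
    "('a::euclidean_space \<Rightarrow> real) \<Rightarrow> ('a \<Rightarrow> complex) \<Rightarrow> ('a \<Rightarrow> complex) \<Rightarrow> complex" where
  "energy_form a \<phi> \<psi> = (LINT x|lborel. complex_of_real (a x) *
     (\<Sum>b\<in>Basis. partial_deriv b \<phi> x * cnj (partial_deriv b \<psi> x)))"

lemma energy_form_diag: "energy_form a \<phi> \<phi> = complex_of_real (energy a \<phi>)"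
  unfolding energy_form_def energy_def
  by (simp flip: complex_norm_square of_real_power of_real_sum of_real_mult)

text \<open>Convergence of test functions to \<open>u\<close> in \<open>L\<^sup>2\<close> that is Cauchy for the energy; the limits
  of such sequences form the domain of the closure of the form.\<close>

definition form_converges ::
    "('a::euclidean_space \<Rightarrow> real) \<Rightarrow> (nat \<Rightarrow> 'a \<Rightarrow> complex) \<Rightarrow> 'a l2 \<Rightarrow> bool" where
  "form_converges a \<phi> u \<longleftrightarrow>
     (\<forall>n. \<phi> n \<in> test_functions) \<and>
     (\<lambda>n. abs_l2 (\<phi> n)) \<longlonglongrightarrow> u \<and>
     (\<forall>e>0. \<exists>M. \<forall>m\<ge>M. \<forall>n\<ge>M. energy a (\<lambda>x. \<phi> m x - \<phi> n x) < e)"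

definition closed_form_dom :: "('a::euclidean_space \<Rightarrow> real) \<Rightarrow> 'a l2 set" where
  "closed_form_dom a = {u. \<exists>\<phi>. form_converges a \<phi> u}"

text \<open>Closability of the form is what makes the limit below independent of the sequences.\<close>

definition closed_form :: "('a::euclidean_space \<Rightarrow> real) \<Rightarrow> 'a l2 \<Rightarrow> 'a l2 \<Rightarrow> complex" where
  "closed_form a u v =
     (THE w. \<forall>\<phi> \<psi>. form_converges a \<phi> u \<longrightarrow> form_converges a \<psi> v \<longrightarrow>
        (\<lambda>n. energy_form a (\<phi> n) (\<psi> n)) \<longlonglongrightarrow> w)"

text \<open>The operator associated with the closed form: \<open>H u = w\<close> iff \<open>u\<close> lies in the form domain
  and \<open>Q(u, v) = \<langle>w, v\<rangle>\<close> for all \<open>v\<close> in the form domain.\<close>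

definition friedrichs :: "('a::euclidean_space \<Rightarrow> real) \<Rightarrow> 'a l2_graph" where
  "friedrichs a = {(u, w). u \<in> closed_form_dom a \<and>
     (\<forall>v\<in>closed_form_dom a. closed_form a u v = cinner w v)}"

end

theory Submission
  imports Defs
begin

text \<open>
Conjugating the operator with the plane wave \<open>V\<^sub>k\<close> conjugates its quadratic form, and since the
gradient of \<open>V\<^sub>k f\<close> differs from \<open>V\<^sub>k\<close> applied to the gradient of \<open>f\<close> only by the zeroth-order term
\<open>\<i> k V\<^sub>k f\<close>, a bounded coefficient makes the form and its conjugate comparable: each is at most
\<open>1 + \<delta>\<close> times the other (after adding \<open>\<alpha> \<bar>f\<bar>\<^sup>2\<close>), with \<open>\<delta> \<rightarrow> 0\<close> as \<open>k \<rightarrow> 0\<close>. This is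
\<open>twisted_form_bound\<close>. The resolvents \<open>A\<close> and \<open>V\<^sub>k A V\<^sub>-\<^sub>k\<close> applied to \<open>g\<close> are the minimizers of the
functionals \<open>q(f) - 2 Re \<langle>g, f\<rangle>\<close> for these two forms on the same domain. Two uniformly
comparable forms have close minimizers, and a short computation with quadratic forms gives the
norm estimate \<open>\<surd>(2 \<delta>) / \<alpha>\<close> for the difference (\<open>resolvent_mod_op_bound\<close>).

The Friedrichs extension itself is handled through the gradient weighted with \<open>\<surd>a\<close>, regarded as
an operator from \<open>L\<^sup>2\<close> into the vector-valued \<open>L\<^sup>2\<close> space. Its graph on test functions is closable
(\<open>grad_graph_closable\<close>): integration by parts applies because \<open>a\<close> is continuously
differentiable, and a function orthogonal to all test functions vanishes. Hence the closed form is
the inner product of the closed gradients (\<open>closed_form_eq_cinner\<close>), and the operator is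
described by a weak equation over the closed graph (\<open>friedrichs_iff\<close>). Since \<open>L\<^sup>2\<close> is complete,
orthogonal projection onto the closed graph solves the resolvent equation for every
\<open>\<alpha> > 0\<close> (\<open>friedrichs_solution_exists\<close>); positivity gives uniqueness and the bound \<open>1 / \<alpha>\<close>, and
self-adjointness follows from symmetry together with surjectivity of \<open>H + 1\<close>.
\<close>

section \<open>Differentiability classes\<close>

lemma partial_deriv_eqI:
  "(f has_derivative f') (at x) \<Longrightarrow> partial_deriv b f x = f' b"
  unfolding partial_deriv_def using frechet_derivative_at by metis

lemma has_derivative_partial_deriv:
  assumes "f differentiable (at x)"
  shows "(f has_derivative (\<lambda>b. partial_deriv b f x)) (at x)"
  using assms unfolding partial_deriv_def frechet_derivative_works by simp

lemma C_k_SucD: "C_k (Suc n) f \<Longrightarrow> C_k n f"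
proof (induction n arbitrary: f)
  case 0
  then have "\<forall>x. f differentiable at x" by simp
  then show ?case
    by (auto intro!: differentiable_imp_continuous_on simp: differentiable_on_def
        intro: differentiable_at_withinI)
qed simp

lemma C_k_bounded_linear:
  assumes "bounded_linear h" "C_k n f"
  shows "C_k n (\<lambda>x. h (f x))"
  using assms(2)
proof (induction n arbitrary: f)
  case 0
  then show ?case
    using bounded_linear.continuous_on[OF assms(1)] by auto
next
  case (Suc n)
  have D: "((\<lambda>x. h (f x)) has_derivative (\<lambda>b. h (partial_deriv b f x))) (at x)" for x
    using Suc.prems bounded_linear.has_derivative[OF assms(1) has_derivative_partial_deriv] by auto
  have "partial_deriv b (\<lambda>x. h (f x)) = (\<lambda>x. h (partial_deriv b f x))" for b
    using partial_deriv_eqI[OF D] by auto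
  with D Suc show ?case by (auto simp: differentiable_def)
qed

lemma C_k_add: "C_k n f \<Longrightarrow> C_k n g \<Longrightarrow> C_k n (\<lambda>x. f x + g x)"
proof (induction n arbitrary: f g)
  case 0
  then show ?case by (auto intro: continuous_intros)
next
  case (Suc n)
  have D: "((\<lambda>x. f x + g x) has_derivative (\<lambda>b. partial_deriv b f x + partial_deriv b g x)) (at x)" for x
    using Suc.prems by (auto intro!: has_derivative_add has_derivative_partial_deriv)
  have "partial_deriv b (\<lambda>x. f x + g x) = (\<lambda>x. partial_deriv b f x + partial_deriv b g x)" for b
    using partial_deriv_eqI[OF D] by auto
  with D Suc show ?case by (auto simp: differentiable_def)
qed

lemma partial_deriv_mult:
  fixes f g :: "'a::euclidean_space \<Rightarrow> 'b::real_normed_algebra"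
  assumes "f differentiable (at x)" "g differentiable (at x)"
  shows "partial_deriv b (\<lambda>x. f x * g x) x = f x * partial_deriv b g x + partial_deriv b f x * g x"
  using assms by (intro partial_deriv_eqI has_derivative_mult has_derivative_partial_deriv)

text \<open>The product rule puts the undifferentiated factors next to the differentiated ones, so the
induction on the order needs that the classes decrease.\<close>

lemma C_k_mult:
  fixes f g :: "'a::euclidean_space \<Rightarrow> 'b::real_normed_algebra"
  shows "C_k n f \<Longrightarrow> C_k n g \<Longrightarrow> C_k n (\<lambda>x. f x * g x)"
proof (induction n arbitrary: f g)
  case 0
  then show ?case by (auto intro: continuous_intros)
next
  case (Suc n)
  have "partial_deriv b (\<lambda>x. f x * g x)
      = (\<lambda>x. f x * partial_deriv b g x + partial_deriv b f x * g x)" for b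
    using Suc.prems by (auto simp: partial_deriv_mult)
  with Suc.prems Suc.IH C_k_SucD[OF Suc.prems(1)] C_k_SucD[OF Suc.prems(2)] show ?case
    by (auto intro!: C_k_add differentiable_mult)
qed

lemma C_k_const: "C_k n (\<lambda>x. c)"
proof (induction n arbitrary: c)
  case (Suc n)
  have "partial_deriv b (\<lambda>x. c) = (\<lambda>x. 0)" for b :: 'a
    by (auto intro!: partial_deriv_eqI derivative_intros)
  with Suc show ?case by auto
qed auto

lemma C_k_prod:
  fixes f :: "'i \<Rightarrow> 'a::euclidean_space \<Rightarrow> 'b::real_normed_field"
  assumes "\<And>i. i \<in> I \<Longrightarrow> C_k n (f i)"
  shows "C_k n (\<lambda>x. \<Prod>i\<in>I. f i x)"
  using assms by (induction I rule: infinite_finite_induct) (auto intro: C_k_mult C_k_const)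

definition plane_wave :: "'a::euclidean_space \<Rightarrow> 'a \<Rightarrow> complex" where
  "plane_wave k x = exp (\<i> * complex_of_real (k \<bullet> x))"

lemma has_derivative_plane_wave:
  "(plane_wave k has_derivative (\<lambda>b. \<i> * complex_of_real (k \<bullet> b) * plane_wave k x)) (at x)"
proof -
  have "((\<lambda>x. \<i> * complex_of_real (k \<bullet> x)) has_derivative (\<lambda>b. \<i> * complex_of_real (k \<bullet> b))) (at x)"
    by (auto intro!: derivative_eq_intros bounded_linear.has_derivative[OF bounded_linear_of_real])
  from has_derivative_compose[OF this DERIV_exp[unfolded has_field_derivative_def]]
  show ?thesis by (simp add: plane_wave_def[abs_def] mult.commute)
qed

lemma partial_deriv_plane_wave:
  "partial_deriv b (plane_wave k) x = \<i> * complex_of_real (k \<bullet> b) * plane_wave k x"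
  by (rule partial_deriv_eqI[OF has_derivative_plane_wave])

lemma C_k_plane_wave: "C_k n (plane_wave k)"
proof (induction n)
  case 0
  have "continuous_on UNIV (plane_wave k)"
    unfolding plane_wave_def by (intro continuous_intros)
  then show ?case by simp
next
  case (Suc n)
  have "partial_deriv b (plane_wave k) = (\<lambda>x. (\<i> * complex_of_real (k \<bullet> b)) * plane_wave k x)" for b
    by (auto simp: partial_deriv_plane_wave)
  then show ?case
    using Suc has_derivative_plane_wave[of k] by (auto simp: differentiable_def intro: C_k_mult C_k_const)
qed

text \<open>The functions \<open>flat m\<close> are closed under differentiation up to linear combinations: the
derivative of \<open>exp (- 1 / t) / t ^ m\<close> is a combination of the same expressions with \<open>m + 1\<close> and
\<open>m + 2\<close>. This makes \<open>flat 0\<close>, the standard smooth function that is flat at \<open>0\<close>, accessible to a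
single induction in which \<open>m\<close> varies.\<close>

definition flat :: "nat \<Rightarrow> real \<Rightarrow> real" where
  "flat m t = (if t > 0 then exp (- 1 / t) / t ^ m else 0)"

lemma flat_bounds: "0 \<le> flat 0 t" "flat 0 t \<le> 1"
  by (auto simp: flat_def)

lemma flat_right_limit: "((\<lambda>t. exp (- 1 / t) / t ^ m) \<longlongrightarrow> (0::real)) (at_right 0)"
proof -
  have "((\<lambda>s. s ^ m / exp s) \<longlongrightarrow> (0::real)) at_top"
    by (rule tendsto_power_div_exp_0)
  then have "((\<lambda>t. inverse t ^ m / exp (inverse t)) \<longlongrightarrow> (0::real)) (at_right 0)"
    by (rule filterlim_compose[OF _ filterlim_inverse_at_top_right])
  then show ?thesis by (simp add: exp_minus divide_simps inverse_eq_divide power_divide mult.commute)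
qed

text \<open>Away from the origin this is calculus; at the origin the difference quotient is
\<open>flat (m + 1)\<close> on the right, which tends to \<open>0\<close>.\<close>

lemma has_real_derivative_flat:
  "(flat m has_real_derivative (flat (m + 2) t - of_nat m * flat (m + 1) t)) (at t)"
proof -
  consider "t > 0" | "t < 0" | "t = 0" by linarith
  then show ?thesis
  proof cases
    case 1
    have "((\<lambda>t. exp (- 1 / t) / t ^ m) has_real_derivative
        (flat (m + 2) t - of_nat m * flat (m + 1) t)) (at t)"
      using 1
      apply (cases m)
       apply (auto intro!: derivative_eq_intros simp: flat_def power2_eq_square field_simps)
      apply (metis Suc_pred power_Suc not_gr_zero)
      done
    moreover have "\<forall>\<^sub>F s in nhds t. exp (- 1 / s) / s ^ m = flat m s"
      using eventually_nhds_in_open[of "{0<..}" t] 1 by (auto elim!: eventually_mono simp: flat_def)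
    ultimately show ?thesis
      using 1 by (subst DERIV_cong_ev[OF refl _ refl, where g = "\<lambda>t. exp (- 1 / t) / t ^ m"])
        (auto elim!: eventually_mono)
  next
    case 2
    have "\<forall>\<^sub>F s in nhds t. flat m s = 0"
      using eventually_nhds_in_open[of "{..<0}" t] 2 by (auto elim!: eventually_mono simp: flat_def)
    then have "(flat m has_real_derivative 0) (at t)"
      by (subst DERIV_cong_ev[OF refl _ refl, where g = "\<lambda>t. 0"]) auto
    then show ?thesis using 2 by (simp add: flat_def)
  next
    case 3
    have "((\<lambda>t. flat m t / t) \<longlongrightarrow> 0) (at_right 0)"
      using flat_right_limit[of "Suc m"]
      by (rule Lim_transform_eventually)
        (auto simp: eventually_at_right_field flat_def field_simps intro!: exI[of _ 1])
    moreover have "((\<lambda>t. flat m t / t) \<longlongrightarrow> 0) (at_left 0)"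
      by (rule tendsto_eventually)
        (auto simp: eventually_at_left_field flat_def intro!: exI[of _ "-1"])
    ultimately have "((\<lambda>t. flat m t / t) \<longlongrightarrow> 0) (at 0)"
      by (simp add: filterlim_split_at)
    then show ?thesis
      using 3 by (simp add: has_field_derivative_iff flat_def)
  qed
qed

lemma has_derivative_flat_affine:
  "((\<lambda>x. flat m (w \<bullet> x + d)) has_derivative
     (\<lambda>b. (w \<bullet> b) * (flat (m + 2) (w \<bullet> x + d) - of_nat m * flat (m + 1) (w \<bullet> x + d)))) (at x)"
proof -
  have "((\<lambda>x. w \<bullet> x + d) has_derivative (\<lambda>b. w \<bullet> b)) (at x)"
    by (auto intro!: derivative_eq_intros)
  from has_derivative_compose[OF this has_real_derivative_flat[unfolded has_field_derivative_def]]
  show ?thesis by (simp add: mult.commute)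
qed

lemma C_k_flat: "C_k n (\<lambda>x::'a::euclidean_space. flat m (w \<bullet> x + d))"
proof (induction n arbitrary: m)
  case 0
  have "continuous_on UNIV (\<lambda>x. flat m (w \<bullet> x + d))"
    using has_derivative_flat_affine by (rule has_derivative_continuous_on)
  then show ?case by simp
next
  case (Suc n)
  have "partial_deriv b (\<lambda>x. flat m (w \<bullet> x + d))
      = (\<lambda>x. (w \<bullet> b) * (flat (m + 2) (w \<bullet> x + d) + (- of_nat m) * flat (m + 1) (w \<bullet> x + d)))" for b
    using partial_deriv_eqI[OF has_derivative_flat_affine] by fastforce
  moreover have "C_k n (\<lambda>x. (w \<bullet> b) * (flat (m + 2) (w \<bullet> x + d) + (- of_nat m) * flat (m + 1) (w \<bullet> x + d)))" for b
    by (intro C_k_mult C_k_const C_k_add Suc)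
  moreover have "(\<lambda>x. flat m (w \<bullet> x + d)) differentiable (at x)" for x
    using has_derivative_flat_affine unfolding differentiable_def by blast
  ultimately show ?case by simp
qed

section \<open>Test functions\<close>

lemma test_functionsI:
  assumes "\<And>n. C_k n \<phi>" "compact K" "\<And>x. \<phi> x \<noteq> 0 \<Longrightarrow> x \<in> K"
  shows "\<phi> \<in> test_functions"
proof -
  have "closure {x. \<phi> x \<noteq> 0} \<subseteq> K"
    using assms(2,3) by (intro closure_minimal compact_imp_closed) auto
  then have "compact (closure {x. \<phi> x \<noteq> 0})"
    using compact_Int_closed[OF assms(2) closed_closure[of "{x. \<phi> x \<noteq> 0}"]] by (simp add: Int_absorb1)
  with assms(1) show ?thesis by (simp add: test_functions_def)
qed

lemma test_functions_compact_support:
  assumes "\<phi> \<in> test_functions"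
  shows "\<exists>K. compact K \<and> (\<forall>x. x \<notin> K \<longrightarrow> \<phi> x = 0)"
proof (intro exI conjI allI impI)
  show "compact (closure {x. \<phi> x \<noteq> 0})" using assms by (simp add: test_functions_def)
  show "\<phi> x = 0" if "x \<notin> closure {x. \<phi> x \<noteq> 0}" for x
    using that subsetD[OF closure_subset, of x "{x. \<phi> x \<noteq> 0}"] by blast
qed

lemma test_functions_C_k: "\<phi> \<in> test_functions \<Longrightarrow> C_k n \<phi>"
  by (simp add: test_functions_def)

lemma test_functions_differentiable: "\<phi> \<in> test_functions \<Longrightarrow> \<phi> differentiable (at x)"
  using test_functions_C_k[of \<phi> "Suc 0"] by (simp only: C_k.simps)

lemma test_functions_add:
  assumes "\<phi> \<in> test_functions" "\<psi> \<in> test_functions"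
  shows "(\<lambda>x. \<phi> x + \<psi> x) \<in> test_functions"
proof -
  obtain K where K: "compact K" "\<And>x. x \<notin> K \<Longrightarrow> \<phi> x = 0"
    using test_functions_compact_support[OF assms(1)] by blast
  obtain L where L: "compact L" "\<And>x. x \<notin> L \<Longrightarrow> \<psi> x = 0"
    using test_functions_compact_support[OF assms(2)] by blast
  show ?thesis
  proof (rule test_functionsI)
    show "C_k n (\<lambda>x. \<phi> x + \<psi> x)" for n
      using assms by (simp add: C_k_add test_functions_C_k)
    show "compact (K \<union> L)" using K L by (simp add: compact_Un)
    show "x \<in> K \<union> L" if "\<phi> x + \<psi> x \<noteq> 0" for x
      using that K L by fastforce
  qed
qed

lemma test_functions_smooth_mult:
  assumes "\<And>n. C_k n g" "\<phi> \<in> test_functions"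
  shows "(\<lambda>x. g x * \<phi> x) \<in> test_functions"
proof -
  obtain K where K: "compact K" "\<And>x. x \<notin> K \<Longrightarrow> \<phi> x = 0"
    using test_functions_compact_support[OF assms(2)] by blast
  show ?thesis
  proof (rule test_functionsI)
    show "C_k n (\<lambda>x. g x * \<phi> x)" for n
      by (intro C_k_mult assms(1) test_functions_C_k[OF assms(2)])
    show "compact K" by (rule K)
    show "x \<in> K" if "g x * \<phi> x \<noteq> 0" for x
      using that K(2) by fastforce
  qed
qed

lemma test_functions_scale: "\<phi> \<in> test_functions \<Longrightarrow> (\<lambda>x. c * \<phi> x) \<in> test_functions"
  by (rule test_functions_smooth_mult[OF C_k_const])

lemma test_functions_diff:
  "\<phi> \<in> test_functions \<Longrightarrow> \<psi> \<in> test_functions \<Longrightarrow> (\<lambda>x. \<phi> x - \<psi> x) \<in> test_functions"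
  using test_functions_add[of \<phi> "\<lambda>x. (-1) * \<psi> x"] test_functions_scale[of \<psi> "-1"] by simp

lemma partial_deriv_eq_0_outside:
  assumes "compact K" "\<And>x. x \<notin> K \<Longrightarrow> f x = 0" "x \<notin> K"
  shows "partial_deriv b f x = 0"
proof (rule partial_deriv_eqI)
  show "(f has_derivative (\<lambda>b. 0)) (at x)"
    by (rule has_derivative_transform_within_open[where f = "\<lambda>x. 0" and s = "- K"])
      (use assms in \<open>auto intro: compact_imp_closed\<close>)
qed

lemma test_functions_partial_deriv:
  assumes "\<phi> \<in> test_functions" "b \<in> Basis"
  shows "partial_deriv b \<phi> \<in> test_functions"
proof -
  obtain K where K: "compact K" "\<And>x. x \<notin> K \<Longrightarrow> \<phi> x = 0"
    using test_functions_compact_support[OF assms(1)] by blast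
  show ?thesis
  proof (rule test_functionsI[of _ K])
    fix n show "C_k n (partial_deriv b \<phi>)"
      using test_functions_C_k[OF assms(1), of "Suc n"] assms(2) by simp
    show "compact K" by (rule K)
    show "x \<in> K" if "partial_deriv b \<phi> x \<noteq> 0" for x
      using that partial_deriv_eq_0_outside[of K \<phi> x b] K by blast
  qed
qed

text \<open>Since \<open>exp (- 1 / (n t))\<close> increases to \<open>1\<close> for every \<open>t > 0\<close>, rescaling the argument of
\<open>flat 0\<close> turns smooth bumps into the indicator of the open box. The factor \<open>Suc n\<close> keeps the
scaling positive for every index.\<close>

definition box_bump :: "'a::euclidean_space \<Rightarrow> 'a \<Rightarrow> nat \<Rightarrow> 'a \<Rightarrow> real" where
  "box_bump l u n x =
     (\<Prod>b\<in>Basis. flat 0 (real (Suc n) * (x \<bullet> b - l \<bullet> b)) * flat 0 (real (Suc n) * (u \<bullet> b - x \<bullet> b)))"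

lemma box_bump_bounds: "0 \<le> box_bump l u n x" "box_bump l u n x \<le> 1"
  unfolding box_bump_def
  by (intro prod_nonneg ballI mult_nonneg_nonneg flat_bounds)
    (intro prod_le_1 conjI mult_nonneg_nonneg mult_le_one flat_bounds)

lemma box_bump_eq_0: "x \<notin> box l u \<Longrightarrow> box_bump l u n x = 0"
  unfolding box_bump_def
proof (rule prod_zero)
  assume "x \<notin> box l u"
  then obtain b where b: "b \<in> Basis" "x \<bullet> b - l \<bullet> b \<le> 0 \<or> u \<bullet> b - x \<bullet> b \<le> 0"
    by (auto simp: mem_box not_less)
  moreover have "flat 0 (real (Suc n) * t) = 0" if "t \<le> 0" for t
    using mult_nonneg_nonpos[OF of_nat_0_le_iff that, of "Suc n"] by (simp only: flat_def if_False not_less[symmetric])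
  ultimately show "\<exists>b\<in>Basis. flat 0 (real (Suc n) * (x \<bullet> b - l \<bullet> b))
      * flat 0 (real (Suc n) * (u \<bullet> b - x \<bullet> b)) = 0"
    by (intro bexI[of _ b]) auto
qed simp

lemma box_bump_tendsto: "(\<lambda>n. box_bump l u n x) \<longlonglongrightarrow> indicator (box l u) x"
proof (cases "x \<in> box l u")
  case True
  have *: "(\<lambda>n. flat 0 (real (Suc n) * t)) \<longlonglongrightarrow> 1" if "t > 0" for t
  proof -
    have "filterlim (\<lambda>n. real (Suc n) * t) at_top sequentially"
      using that by (intro filterlim_at_top_mult_tendsto_pos[OF tendsto_const _
          filterlim_compose[OF filterlim_real_sequentially filterlim_Suc]])
    then have "(\<lambda>n. inverse (real (Suc n) * t)) \<longlonglongrightarrow> 0"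
      by (rule tendsto_inverse_0_at_top)
    then have "(\<lambda>n. exp (- inverse (real (Suc n) * t))) \<longlonglongrightarrow> exp (- 0)"
      by (intro tendsto_intros)
    then show ?thesis
      using that by (simp add: flat_def inverse_eq_divide add_pos_nonneg)
  qed
  have "(\<lambda>n. box_bump l u n x) \<longlonglongrightarrow> (\<Prod>b\<in>(Basis::'a set). 1 * 1)"
    unfolding box_bump_def using True
    by (intro tendsto_prod tendsto_mult *) (auto simp: mem_box)
  then show ?thesis using True by simp
qed (simp add: box_bump_eq_0)

lemma test_functions_box_bump: "(\<lambda>x. c * complex_of_real (box_bump l u n x)) \<in> test_functions"
proof (rule test_functionsI[of _ "cbox l u"])
  fix m
  have "C_k m (\<lambda>x. flat 0 (real (Suc n) * (x \<bullet> b - l \<bullet> b)))" for b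
    using C_k_flat[of m 0 "real (Suc n) *\<^sub>R b" "- (real (Suc n) * (l \<bullet> b))"]
    by (simp add: inner_commute right_diff_distrib)
  moreover have "C_k m (\<lambda>x. flat 0 (real (Suc n) * (u \<bullet> b - x \<bullet> b)))" for b
    using C_k_flat[of m 0 "(- real (Suc n)) *\<^sub>R b" "real (Suc n) * (u \<bullet> b)"]
    by (simp add: inner_commute right_diff_distrib algebra_simps)
  ultimately have "C_k m (box_bump l u n)"
    unfolding box_bump_def[abs_def] by (intro C_k_prod C_k_mult)
  then show "C_k m (\<lambda>x. c * complex_of_real (box_bump l u n x))"
    by (intro C_k_mult C_k_const C_k_bounded_linear[OF bounded_linear_of_real])
next
  fix x assume "c * complex_of_real (box_bump l u n x) \<noteq> 0"
  then show "x \<in> cbox l u" using box_bump_eq_0[of x l u n] box_subset_cbox by fastforce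
qed auto

section \<open>The integral of a partial derivative\<close>

lemma C_1_iff:
  "C_k 1 f \<longleftrightarrow> (\<forall>x. f differentiable (at x)) \<and> (\<forall>b\<in>Basis. continuous_on UNIV (partial_deriv b f))"
  unfolding One_nat_def C_k.simps ..

lemma integrable_continuous_compact_support:
  fixes f :: "'a::euclidean_space \<Rightarrow> 'b::{banach, second_countable_topology}"
  assumes "continuous_on UNIV f" "compact K" "\<And>x. x \<notin> K \<Longrightarrow> f x = 0"
  shows "integrable lborel f"
proof -
  have "integrable lborel (\<lambda>x. indicator K x *\<^sub>R f x)"
    using assms(2) continuous_on_subset[OF assms(1)] by (intro borel_integrable_compact) auto
  also have "(\<lambda>x. indicator K x *\<^sub>R f x) = f"
    using assms(3) by (auto simp: indicator_def)
  finally show ?thesis .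
qed

lemma integral_translate_lborel:
  fixes f :: "'a::euclidean_space \<Rightarrow> 'b::{banach, second_countable_topology}"
  assumes "f \<in> borel_measurable borel"
  shows "(LINT x|lborel. f (x + c)) = (LINT x|lborel. f x)"
proof -
  have "(LINT x|lborel. f x) = (LINT x|distr lborel borel ((+) c). f x)"
    by (simp add: lborel_distr_plus)
  also have "\<dots> = (LINT x|lborel. f (c + x))"
    using assms by (intro integral_distr) auto
  finally show ?thesis by (simp add: add.commute)
qed

text \<open>The boundary-free divergence theorem. The difference quotients of \<open>F\<close> in direction \<open>b\<close> have
integral zero because Lebesgue measure is translation invariant; they are bounded by the
supremum of the derivative and vanish outside a fixed ball, so dominated convergence applies.\<close>

lemma integral_partial_deriv_eq_0:
  fixes F :: "'a::euclidean_space \<Rightarrow> 'b::euclidean_space"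
  assumes F: "C_k 1 F" and K: "compact K" "\<And>x. x \<notin> K \<Longrightarrow> F x = 0" and b: "b \<in> Basis"
  shows "(LINT x|lborel. partial_deriv b F x) = 0"
proof -
  define g where "g = partial_deriv b F"
  define h where "h n = 1 / real (Suc n)" for n
  have h: "0 < h n" "h n \<le> 1" "h n \<noteq> 0" for n by (auto simp: h_def)
  have diff: "F differentiable (at x)" for x
    using F unfolding C_1_iff by blast
  have contF: "continuous_on UNIV F"
    using C_k_SucD[OF F[unfolded One_nat_def]] by simp
  have contg: "continuous_on UNIV g"
    using F b unfolding C_1_iff g_def by blast
  have [measurable]: "F \<in> borel_measurable borel" "g \<in> borel_measurable borel"
    using contF contg by (auto intro: borel_measurable_continuous_onI)
  have g0: "x \<notin> K \<Longrightarrow> g x = 0" for x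
    unfolding g_def by (rule partial_deriv_eq_0_outside[of K F]) (use K in auto)
  obtain B where B: "0 < B" "norm (g x) \<le> B" for x
  proof -
    have "bounded (g ` K)"
      using K(1) continuous_on_subset[OF contg] by (intro compact_imp_bounded compact_continuous_image) auto
    then obtain B where "0 < B" "\<forall>x\<in>K. norm (g x) \<le> B"
      by (auto simp: bounded_pos)
    then have "norm (g x) \<le> B" for x
      using g0[of x] by (cases "x \<in> K") auto
    with \<open>0 < B\<close> show ?thesis by (rule that)
  qed
  obtain R where R: "K \<subseteq> cball 0 R"
    using compact_imp_bounded[OF K(1)] by (auto simp: bounded_iff subset_iff)
  have nb: "norm b = 1" using b by simp
  define q where "q n x = (F (x + h n *\<^sub>R b) - F x) /\<^sub>R h n" for n x
  \<comment> \<open>The mean value inequality along the segment bounds the difference quotients uniformly.\<close>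
  have lip: "norm (F (x + h n *\<^sub>R b) - F x) \<le> B * h n" for n x
  proof -
    have D: "((\<lambda>t. F (x + t *\<^sub>R b)) has_derivative (\<lambda>s. s *\<^sub>R g (x + t *\<^sub>R b))) (at t within {0..h n})" for t
    proof -
      have "((\<lambda>t. x + t *\<^sub>R b) has_derivative (\<lambda>s. s *\<^sub>R b)) (at t within {0..h n})"
        by (auto intro!: derivative_eq_intros)
      from has_derivative_compose[OF this has_derivative_partial_deriv[OF diff]]
      have 1: "((\<lambda>t. F (x + t *\<^sub>R b)) has_derivative
          (\<lambda>s. partial_deriv (s *\<^sub>R b) F (x + t *\<^sub>R b))) (at t within {0..h n})" .
      have "partial_deriv (s *\<^sub>R b) F y = s *\<^sub>R g y" for s y
        unfolding g_def
        by (rule linear_scale[OF has_derivative_linear[OF has_derivative_partial_deriv[OF diff[of y]]]])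
      with 1 show ?thesis by simp
    qed
    have "norm (F (x + h n *\<^sub>R b) - F (x + 0 *\<^sub>R b)) \<le> B * norm (h n - 0)"
    proof (rule differentiable_bound[OF _ D])
      show "onorm (\<lambda>s. s *\<^sub>R g (x + t *\<^sub>R b)) \<le> B" for t
        using B by (intro onorm_bound) (auto simp: mult.commute[of B] intro: mult_left_mono less_imp_le)
    qed (use h(1)[of n] in auto)
    then show ?thesis using h(1)[of n] by simp
  qed
  have lim: "(\<lambda>n. q n x) \<longlonglongrightarrow> g x" for x
  proof -
    have "((\<lambda>k. norm (F (x + k) - F x - partial_deriv k F x) / norm k) \<longlongrightarrow> 0) (at 0)"
      using has_derivative_partial_deriv[OF diff[of x]] by (simp add: has_derivative_at)
    moreover have "filterlim (\<lambda>n. h n *\<^sub>R b) (at 0) sequentially"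
    proof (rule filterlim_atI)
      have "h \<longlonglongrightarrow> 0" unfolding h_def by (rule LIMSEQ_Suc[OF lim_1_over_n])
      then show "(\<lambda>n. h n *\<^sub>R b) \<longlonglongrightarrow> 0"
        using tendsto_scaleR[OF _ tendsto_const[of b]] by fastforce
      show "\<forall>\<^sub>F n in sequentially. h n *\<^sub>R b \<noteq> 0"
        using h(3) nb by auto
    qed
    ultimately have "(\<lambda>n. norm (F (x + h n *\<^sub>R b) - F x - partial_deriv (h n *\<^sub>R b) F x) / norm (h n *\<^sub>R b))
        \<longlonglongrightarrow> 0"
      by (rule filterlim_compose)
    moreover have "norm (F (x + h n *\<^sub>R b) - F x - partial_deriv (h n *\<^sub>R b) F x) / norm (h n *\<^sub>R b)
        = norm (q n x - g x)" for n
    proof -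
      have "partial_deriv (h n *\<^sub>R b) F x = h n *\<^sub>R g x"
        unfolding g_def
        by (rule linear_scale[OF has_derivative_linear[OF has_derivative_partial_deriv[OF diff[of x]]]])
      moreover have "q n x - g x = (F (x + h n *\<^sub>R b) - F x - h n *\<^sub>R g x) /\<^sub>R h n"
        using h(3) by (simp add: q_def scaleR_diff_right)
      ultimately show ?thesis
        using h(1)[of n] nb by (simp add: divide_inverse mult.commute)
    qed
    ultimately have "(\<lambda>n. norm (q n x - g x)) \<longlonglongrightarrow> 0" by simp
    then show ?thesis by (simp add: tendsto_norm_zero_iff LIM_zero_iff)
  qed
  have int0: "(LINT x|lborel. q n x) = 0" for n
  proof -
    have i: "integrable lborel F"
      by (rule integrable_continuous_compact_support[OF contF K])
    have i2: "integrable lborel (\<lambda>x. F (x + h n *\<^sub>R b))"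
    proof (rule integrable_continuous_compact_support)
      show "continuous_on UNIV (\<lambda>x. F (x + h n *\<^sub>R b))"
        by (rule continuous_on_compose2[OF contF]) (auto intro!: continuous_intros)
      show "compact ((\<lambda>x. x - h n *\<^sub>R b) ` K)"
        using K(1) by (intro compact_continuous_image continuous_intros)
      show "F (x + h n *\<^sub>R b) = 0" if "x \<notin> (\<lambda>x. x - h n *\<^sub>R b) ` K" for x
        using that K(2)[of "x + h n *\<^sub>R b"] by force
    qed
    show ?thesis
      unfolding q_def using i i2 by (simp add: integral_translate_lborel)
  qed
  have "(\<lambda>n. LINT x|lborel. q n x) \<longlonglongrightarrow> (LINT x|lborel. g x)"
  proof (rule integral_dominated_convergence)
    show "integrable lborel (\<lambda>x. B * indicator (cball 0 (R + 1)) x :: real)"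
      by (auto intro!: integrable_mult_right integrable_real_indicator emeasure_bounded_finite)
    show "AE x in lborel. (\<lambda>n. q n x) \<longlonglongrightarrow> g x" using lim by simp
    show "AE x in lborel. norm (q n x) \<le> B * indicator (cball 0 (R + 1)) x" for n
    proof (intro always_eventually allI)
      fix x
      show "norm (q n x) \<le> B * indicator (cball 0 (R + 1)) x"
      proof (cases "x \<in> cball 0 (R + 1)")
        case True
        have "norm (q n x) \<le> inverse (h n) * (B * h n)"
          unfolding q_def norm_scaleR using lip[of x n] h(1)[of n] by (simp add: mult_left_mono)
        also have "\<dots> = B" using h(3)[of n] by simp
        finally show ?thesis using True by simp
      next
        case False
        have "norm x \<le> norm (x + h n *\<^sub>R b) + norm (h n *\<^sub>R b)"
          by (metis add_diff_cancel_right' norm_triangle_ineq4)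
        with False h[of n] nb have "x + h n *\<^sub>R b \<notin> K" "x \<notin> K"
          using R by (auto simp: subset_iff)
        then show ?thesis using False K(2) by (simp add: q_def)
      qed
    qed
  qed (auto simp: q_def[abs_def])
  then have "(\<lambda>n. 0 :: 'b) \<longlonglongrightarrow> (LINT x|lborel. g x)" by (simp add: int0)
  then show ?thesis unfolding g_def using LIMSEQ_unique tendsto_const by blast
qed

section \<open>Completeness\<close>

lemma l2_rel_refl [simp]: "l2_rel f f \<longleftrightarrow> square_integrable f"
  by (auto simp: l2_rel_def)

lemma l2_obtain_rep:
  obtains f where "square_integrable f" "u = abs_l2 f"
proof -
  have "\<exists>f. square_integrable f \<and> u = abs_l2 f"
    by (rule l2.abs_induct) auto
  then show ?thesis using that by blast
qed

lemma abs_l2_eq_iff: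
  assumes "square_integrable f" "square_integrable g"
  shows "abs_l2 f = abs_l2 g \<longleftrightarrow> (AE x in lborel. f x = g x)"
  using assms Quotient_rel[OF Quotient_l2, of f g] by (simp add: l2_rel_def)

lemma norm_abs_l2_squared:
  assumes "square_integrable f"
  shows "(norm (abs_l2 f))\<^sup>2 = (LINT x|lborel. (cmod (f x))\<^sup>2)"
proof -
  have "(norm (abs_l2 f))\<^sup>2 = Re (LINT x|lborel. f x * cnj (f x))"
    using assms by (simp add: power2_norm_eq_inner inner_l2_def cinner.abs_eq)
  then show ?thesis by (simp flip: complex_norm_square of_real_power)
qed

lemma nn_integral_cmod_squared:
  assumes "square_integrable f"
  shows "(\<integral>\<^sup>+x. ennreal ((cmod (f x))\<^sup>2) \<partial>lborel) = ennreal ((norm (abs_l2 f))\<^sup>2)"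
  using assms unfolding norm_abs_l2_squared[OF assms]
  by (intro nn_integral_eq_integral) (auto simp: square_integrable_def)

lemma square_integrableI_nn_integral:
  assumes "f \<in> borel_measurable borel" "(\<integral>\<^sup>+x. ennreal ((cmod (f x))\<^sup>2) \<partial>lborel) \<le> ennreal C"
  shows "square_integrable f"
  unfolding square_integrable_def
  using assms by (auto intro!: integrableI_bounded intro: le_less_trans)

text \<open>Riesz--Fischer. Along a subsequence with increments \<open>g k\<close> of norm at most \<open>2\<^sup>-\<^sup>k\<close>, the weighted
series \<open>2\<^sup>k \<bar>g k\<bar>\<^sup>2\<close> has finite integral, hence converges almost everywhere, and
\<open>\<bar>g k\<bar> \<le> 2\<^sup>-\<^sup>k + 2\<^sup>k \<bar>g k\<bar>\<^sup>2\<close> then gives pointwise absolute convergence.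
Fatou's lemma turns the pointwise limit into a limit in norm.\<close>

instance l2 :: (euclidean_space) banach
proof
  fix X :: "nat \<Rightarrow> 'a l2"
  assume X: "Cauchy X"
  obtain f where f: "\<And>n. square_integrable (f n)" "\<And>n. X n = abs_l2 (f n)"
  proof -
    have "\<exists>f. square_integrable f \<and> X n = abs_l2 f" for n
      by (rule l2_obtain_rep[of "X n"]) blast
    then show ?thesis using that by metis
  qed
  have [measurable]: "f n \<in> borel_measurable borel" for n
    using f(1) by (auto simp: square_integrable_def)
  have norm_diff: "norm (abs_l2 (\<lambda>x. f m x - f n x)) = norm (X m - X n)" for m n
    using f by (simp add: minus_l2.abs_eq)
  have "\<forall>k. \<exists>N. \<forall>m\<ge>N. \<forall>n\<ge>N. norm (X m - X n) < (1/2) ^ k"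
    using X by (auto simp: Cauchy_iff)
  then obtain N where N: "\<And>k m n. m \<ge> N k \<Longrightarrow> n \<ge> N k \<Longrightarrow> norm (X m - X n) < (1/2) ^ k"
    by metis
  \<comment> \<open>Adding up the thresholds makes the subsequence monotone while staying above each of them.\<close>
  define r where "r k = (\<Sum>i\<le>k. N i) + k" for k
  have r: "r k \<ge> N k" "r k \<ge> k" for k
    unfolding r_def by (auto intro: trans_le_add1 member_le_sum)
  have "r (Suc k) \<ge> r k" for k by (simp add: r_def)
  define g where "g k x = f (r (Suc k)) x - f (r k) x" for k x
  have g: "square_integrable (g k)" for k
    unfolding g_def by (intro square_integrable_diff f)
  have [measurable]: "g n \<in> borel_measurable borel" for n
    using g by (auto simp: square_integrable_def)
  have ng: "(\<integral>\<^sup>+x. ennreal (2 ^ k * (cmod (g k x))\<^sup>2) \<partial>lborel) \<le> ennreal ((1/2) ^ k)" for k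
  proof -
    have "norm (abs_l2 (g k)) \<le> (1/2) ^ k"
      unfolding g_def norm_diff
      using N[of k "r (Suc k)" "r k"] r(1) \<open>r (Suc k) \<ge> r k\<close> by (meson le_trans less_imp_le)
    then have "(norm (abs_l2 (g k)))\<^sup>2 \<le> ((1/2) ^ k)\<^sup>2"
      by (intro power_mono) auto
    then have "2 ^ k * (norm (abs_l2 (g k)))\<^sup>2 \<le> 2 ^ k * ((1/2) ^ k)\<^sup>2"
      by (intro mult_left_mono) auto
    also have "\<dots> = (1/2) ^ k"
      by (simp add: power2_eq_square power_one_over field_simps flip: power_mult_distrib)
    finally have "ennreal (2 ^ k) * ennreal ((norm (abs_l2 (g k)))\<^sup>2) \<le> ennreal ((1/2) ^ k)"
      by (simp flip: ennreal_mult)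
    then show ?thesis
      using nn_integral_cmod_squared[OF g[of k]] by (simp add: ennreal_mult nn_integral_cmult)
  qed
  have "(\<integral>\<^sup>+x. (\<Sum>k. ennreal (2 ^ k * (cmod (g k x))\<^sup>2)) \<partial>lborel)
      = (\<Sum>k. \<integral>\<^sup>+x. ennreal (2 ^ k * (cmod (g k x))\<^sup>2) \<partial>lborel)"
    by (intro nn_integral_suminf) auto
  also have "\<dots> \<le> (\<Sum>k. ennreal ((1/2) ^ k))"
    by (intro suminf_le ng) auto
  also have "\<dots> = ennreal (\<Sum>k. (1/2) ^ k)"
    by (intro suminf_ennreal2) (auto intro: summable_geometric)
  also have "\<dots> < \<infinity>" by simp
  finally have "(\<integral>\<^sup>+x. (\<Sum>k. ennreal (2 ^ k * (cmod (g k x))\<^sup>2)) \<partial>lborel) \<noteq> \<infinity>" by simp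
  then have "AE x in lborel. (\<Sum>k. ennreal (2 ^ k * (cmod (g k x))\<^sup>2)) \<noteq> \<infinity>"
    by (intro nn_integral_noteq_infinite) auto
  then have conv: "AE x in lborel. convergent (\<lambda>n. f (r n) x)"
  proof eventually_elim
    case (elim x)
    have s: "summable (\<lambda>k. 2 ^ k * (cmod (g k x))\<^sup>2)"
      using elim by (intro summable_suminf_not_top) (auto simp: infinity_ennreal_def)
    have "summable (\<lambda>k. norm (g k x))"
    proof (rule summable_comparison_test'[of "\<lambda>k. (1/2) ^ k + 2 ^ k * (cmod (g k x))\<^sup>2" 0])
      show "summable (\<lambda>k. (1/2) ^ k + 2 ^ k * (cmod (g k x))\<^sup>2)"
        using s by (intro summable_add) (auto intro: summable_geometric)
      fix k
      let ?y = "2 ^ k * cmod (g k x)"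
      \<comment> \<open>This is the inequality between \<open>\<bar>g k\<bar>\<close> and its weighted square, multiplied by \<open>2\<^sup>k\<close>.\<close>
      have "0 \<le> (?y - 1)\<^sup>2 + ?y" by (intro add_nonneg_nonneg) auto
      then have "?y \<le> 1 + ?y\<^sup>2" by (simp add: power2_eq_square algebra_simps)
      then have "?y / 2 ^ k \<le> (1 + ?y\<^sup>2) / 2 ^ k" by (intro divide_right_mono) auto
      then show "norm (norm (g k x)) \<le> (1/2) ^ k + 2 ^ k * (cmod (g k x))\<^sup>2"
        by (simp add: power_one_over field_simps power2_eq_square)
    qed
    then have "summable (\<lambda>k. f (r (Suc k)) x - f (r k) x)"
      unfolding g_def by (rule summable_norm_cancel)
    then have "convergent (\<lambda>n. \<Sum>k<n. f (r (Suc k)) x - f (r k) x)"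
      by (simp add: summable_iff_convergent)
    then have "convergent (\<lambda>n. f (r n) x - f (r 0) x)"
      by (simp add: sum_lessThan_telescope[of "\<lambda>k. f (r k) x"])
    then have "convergent (\<lambda>n. (f (r n) x - f (r 0) x) + f (r 0) x)"
      by (intro convergent_add convergent_const)
    then show ?case by simp
  qed
  define F where "F x = lim (\<lambda>n. f (r n) x)" for x
  have [measurable]: "F \<in> borel_measurable borel"
    unfolding F_def by measurable
  have lim: "AE x in lborel. (\<lambda>n. f (r n) x) \<longlonglongrightarrow> F x"
    using conv by eventually_elim (simp add: F_def convergent_LIMSEQ_iff)
  have Fatou: "(\<integral>\<^sup>+x. ennreal ((cmod (F x - f m x))\<^sup>2) \<partial>lborel) \<le> ennreal (((1/2) ^ k)\<^sup>2)"
    if "m \<ge> N k" for m k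
  proof -
    have "(\<integral>\<^sup>+x. ennreal ((cmod (F x - f m x))\<^sup>2) \<partial>lborel)
        = (\<integral>\<^sup>+x. liminf (\<lambda>n. ennreal ((cmod (f (r n) x - f m x))\<^sup>2)) \<partial>lborel)"
    proof (rule nn_integral_cong_AE)
      show "AE x in lborel. ennreal ((cmod (F x - f m x))\<^sup>2)
          = liminf (\<lambda>n. ennreal ((cmod (f (r n) x - f m x))\<^sup>2))"
        using lim
      proof eventually_elim
        case (elim x)
        then have "(\<lambda>n. ennreal ((cmod (f (r n) x - f m x))\<^sup>2)) \<longlonglongrightarrow> ennreal ((cmod (F x - f m x))\<^sup>2)"
          by (intro tendsto_intros)
        then show ?case by (intro lim_imp_Liminf[symmetric]) auto
      qed
    qed
    also have "\<dots> \<le> liminf (\<lambda>n. \<integral>\<^sup>+x. ennreal ((cmod (f (r n) x - f m x))\<^sup>2) \<partial>lborel)"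
      by (intro nn_integral_liminf) auto
    also have "\<dots> \<le> ennreal (((1/2) ^ k)\<^sup>2)"
    proof (rule Liminf_le)
      show "\<forall>\<^sub>F n in sequentially.
          (\<integral>\<^sup>+x. ennreal ((cmod (f (r n) x - f m x))\<^sup>2) \<partial>lborel) \<le> ennreal (((1/2) ^ k)\<^sup>2)"
        using eventually_ge_at_top[of "N k"]
      proof eventually_elim
        case (elim n)
        then have "norm (X (r n) - X m) \<le> (1/2) ^ k"
          using N[of k "r n" m] r(2)[of n] that by (meson le_trans less_imp_le)
        then show ?case
          by (subst nn_integral_cmod_squared)
            (auto intro!: square_integrable_diff f ennreal_leI power_mono simp: norm_diff)
      qed
    qed simp
    finally show ?thesis .
  qed
  have Fdiff: "square_integrable (\<lambda>x. F x - f m x)" if "m \<ge> N k" for m k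
    using Fatou[OF that] by (intro square_integrableI_nn_integral) auto
  have F: "square_integrable F"
    using square_integrable_add[OF Fdiff[OF order_refl, of 0] f(1)[of "N 0"]] by simp
  have "X \<longlonglongrightarrow> abs_l2 F"
  proof (rule metric_LIMSEQ_I)
    fix e :: real assume "0 < e"
    then obtain k where k: "(1/2) ^ k < e"
      using real_arch_pow_inv[of e "1/2"] by auto
    have "dist (X m) (abs_l2 F) < e" if "m \<ge> N k" for m
    proof -
      have "ennreal ((norm (abs_l2 (\<lambda>x. F x - f m x)))\<^sup>2) \<le> ennreal (((1/2) ^ k)\<^sup>2)"
        using Fatou[OF that] by (simp add: nn_integral_cmod_squared[OF Fdiff[OF that]])
      then have "norm (abs_l2 F - X m) \<le> (1/2) ^ k"
        using f F by (simp add: minus_l2.abs_eq power2_le_iff_abs_le)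
      with k show ?thesis by (simp add: dist_norm norm_minus_commute)
    qed
    then show "\<exists>no. \<forall>n\<ge>no. dist (X n) (abs_l2 F) < e" by blast
  qed
  then show "convergent X" by (auto simp: convergent_def)
qed

section \<open>Orthogonal projection\<close>

text \<open>A minimizing sequence for the distance to \<open>g\<close> is Cauchy by the parallelogram law, and
minimality along every line through the limit \<open>p\<close> forces \<open>g - p\<close> to be orthogonal to \<open>S\<close>. Below, the
projection yields the density of the domain and the solutions of the resolvent equation.\<close>

lemma closed_subspace_projection:
  fixes S :: "'b::{real_inner, complete_space} set" and g :: 'b
  assumes "subspace S" "closed S"
  shows "\<exists>p\<in>S. \<forall>y\<in>S. inner (g - p) y = 0"
proof -
  define J where "J y = (norm (g - y))\<^sup>2" for y
  define m where "m = (INF y\<in>S. J y)"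
  have "S \<noteq> {}" using assms(1) subspace_0 by blast
  have bdd: "bdd_below (J ` S)" by (auto simp: J_def intro!: bdd_belowI[of _ 0])
  have m: "m \<le> J y" if "y \<in> S" for y
    unfolding m_def using bdd that by (rule cINF_lower)
  have "\<exists>y\<in>S. J y < m + 1 / Suc n" for n
    using cINF_less_iff[OF \<open>S \<noteq> {}\<close> bdd, of "m + 1 / Suc n"] by (simp add: m_def)
  then obtain x where x: "\<And>n. x n \<in> S" "\<And>n. J (x n) < m + 1 / Suc n" by metis
  have par: "(norm (y - z))\<^sup>2 \<le> 2 * (J y - m) + 2 * (J z - m)" if "y \<in> S" "z \<in> S" for y z
  proof -
    define w where "w = (1/2) *\<^sub>R (y + z)"
    have "m \<le> J w"
      unfolding w_def
      using assms(1) that by (intro m subspace_scale subspace_add)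
    moreover have "(norm (y - z))\<^sup>2 + 4 * J w = 2 * J y + 2 * J z"
      by (simp add: w_def J_def power2_norm_eq_inner inner_simps inner_commute field_simps)
    ultimately show ?thesis by (simp add: algebra_simps)
  qed
  have "Cauchy x"
  proof (rule metric_CauchyI)
    fix e :: real assume "0 < e"
    then obtain M where M: "1 / real (Suc M) < e\<^sup>2 / 4"
      using nat_approx_posE[of "e\<^sup>2 / 4"] by auto
    have *: "J (x i) - m < e\<^sup>2 / 4" if "i \<ge> M" for i
      using x(2)[of i] that M frac_le[of 1 1 "real (Suc M)" "real (Suc i)"] by simp
    have "dist (x i) (x j) < e" if "i \<ge> M" "j \<ge> M" for i j
    proof -
      have "(norm (x i - x j))\<^sup>2 < e\<^sup>2"
        using par[OF x(1)[of i] x(1)[of j]] *[OF that(1)] *[OF that(2)] by argo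
      with \<open>0 < e\<close> show ?thesis by (simp add: dist_norm power_less_imp_less_base)
    qed
    then show "\<exists>M. \<forall>i\<ge>M. \<forall>j\<ge>M. dist (x i) (x j) < e" by blast
  qed
  then obtain p where p: "x \<longlonglongrightarrow> p"
    using Cauchy_convergent_iff convergent_def by metis
  have "p \<in> S" using assms(2) x(1) p closed_sequentially by blast
  have "J p \<le> m"
  proof (rule LIMSEQ_le)
    show "(\<lambda>n. J (x n)) \<longlonglongrightarrow> J p" unfolding J_def by (intro tendsto_intros p)
    show "(\<lambda>n. m + 1 / real (Suc n)) \<longlonglongrightarrow> m"
      using tendsto_add[OF tendsto_const LIMSEQ_Suc[OF lim_1_over_n], of m] by simp
    show "\<exists>N. \<forall>n\<ge>N. J (x n) \<le> m + 1 / real (Suc n)" using x(2) less_imp_le by blast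
  qed
  have "inner (g - p) y = 0" if "y \<in> S" for y
  proof (cases "y = 0")
    case False
    \<comment> \<open>The choice of \<open>t\<close> minimizes the distance along the line \<open>p + t y\<close>.\<close>
    define t where "t = inner (g - p) y / inner y y"
    have "inner y y > 0" using False by simp
    have "J p \<le> J (p + t *\<^sub>R y)"
      using \<open>J p \<le> m\<close> m[of "p + t *\<^sub>R y"] assms(1) \<open>p \<in> S\<close> that
      by (meson order_trans subspace_add subspace_scale)
    also have "J (p + t *\<^sub>R y) = J p - 2 * t * inner (g - p) y + t * t * inner y y"
      by (simp add: J_def power2_norm_eq_inner inner_simps inner_commute algebra_simps)
    also have "\<dots> = J p - (inner (g - p) y)\<^sup>2 / inner y y"
      using \<open>inner y y > 0\<close> by (simp add: t_def field_simps power2_eq_square)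
    finally have "(inner (g - p) y)\<^sup>2 / inner y y \<le> 0" by simp
    then show ?thesis using \<open>inner y y > 0\<close>
      by (simp add: divide_le_0_iff)
  qed simp
  with \<open>p \<in> S\<close> show ?thesis by blast
qed

lemma subspace_closure:
  fixes S :: "'b::real_normed_vector set"
  assumes "subspace S"
  shows "subspace (closure S)"
proof (rule subspaceI)
  show "0 \<in> closure S"
    using subspace_0[OF assms] closure_subset by blast
next
  fix x y assume "x \<in> closure S" "y \<in> closure S"
  then obtain X Y where "\<And>n. X n \<in> S" "X \<longlonglongrightarrow> x" "\<And>n. Y n \<in> S" "Y \<longlonglongrightarrow> y"
    by (metis closure_sequential)
  then show "x + y \<in> closure S"
    unfolding closure_sequential
    by (intro exI[of _ "\<lambda>n. X n + Y n"]) (auto intro: tendsto_add subspace_add[OF assms])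
next
  fix x and c :: real assume "x \<in> closure S"
  then obtain X where "\<And>n. X n \<in> S" "X \<longlonglongrightarrow> x"
    by (metis closure_sequential)
  then show "c *\<^sub>R x \<in> closure S"
    unfolding closure_sequential
    by (intro exI[of _ "\<lambda>n. c *\<^sub>R X n"]) (auto intro: tendsto_scaleR subspace_scale[OF assms])
qed

lemma closure_subspace_eq_UNIV:
  fixes S :: "'b::{real_inner, complete_space} set"
  assumes "subspace S" "\<And>g. (\<And>y. y \<in> S \<Longrightarrow> inner g y = 0) \<Longrightarrow> g = 0"
  shows "closure S = UNIV"
proof -
  have "g \<in> closure S" for g
  proof -
    obtain p where p: "p \<in> closure S" "\<And>y. y \<in> closure S \<Longrightarrow> inner (g - p) y = 0"
      using closed_subspace_projection[of "closure S" g] subspace_closure[OF assms(1)] by auto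
    have "g - p = 0" using p(2) closure_subset by (intro assms(2)) blast
    with p(1) show ?thesis by simp
  qed
  then show ?thesis by blast
qed

section \<open>Functions orthogonal to the test functions\<close>

text \<open>Boxes form an intersection-stable generator of the Borel sets. On a fixed large box the
function is integrable, and the sets over which its integral vanishes form a Dynkin system.\<close>

lemma AE_eq_0_of_box_integrals:
  fixes f :: "'a::euclidean_space \<Rightarrow> 'b::{banach, second_countable_topology}"
  assumes int: "\<And>l u. set_integrable lborel (box l u) f"
    and zero: "\<And>l u. (LINT x:box l u|lborel. f x) = 0"
  shows "AE x in lborel. f x = 0"
proof -
  define B where "B N = box (- (real N *\<^sub>R One)) (real N *\<^sub>R One :: 'a)" for N :: nat
  have "AE x in lborel. indicator (B N) x *\<^sub>R f x = 0" for N
  proof (rule sigma_finite_measure.density_zero[OF sigma_finite_lborel])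
    let ?f = "\<lambda>x. indicator (B N) x *\<^sub>R f x"
    show fi: "integrable lborel ?f"
      using int unfolding set_integrable_def B_def .
    have si: "set_integrable lborel A ?f" if "A \<in> sets borel" for A
      unfolding set_integrable_def using that by (intro integrable_mult_indicator fi) auto
    fix A :: "'a set" assume "A \<in> sets lborel"
    then have A: "A \<in> sigma_sets UNIV (range (\<lambda>(a, b). box a b))" by (simp add: borel_eq_box)
    have "Int_stable (range (\<lambda>(a, b). box a b :: 'a set))"
      by (auto simp: Int_stable_def box_Int_box)
    moreover have "range (\<lambda>(a, b). box a b :: 'a set) \<subseteq> Pow UNIV" by auto
    ultimately show "(LINT x:A|lborel. ?f x) = 0"
      using A
    proof (induction rule: sigma_sets_induct_disjoint)
      case (basic A)
      then obtain a b where A: "A = box a b" by auto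
      obtain l u where "A \<inter> B N = box l u" unfolding A B_def box_Int_box by blast
      moreover have "(LINT x:A|lborel. ?f x) = (LINT x:A \<inter> B N|lborel. f x)"
        unfolding set_lebesgue_integral_def
        by (intro Bochner_Integration.integral_cong) (auto simp: indicator_def)
      ultimately show ?case using zero by simp
    next
      case empty
      show ?case by (simp add: set_lebesgue_integral_def)
    next
      case (compl A)
      then have "A \<in> sets borel" by (simp add: borel_eq_box)
      then have A: "A \<in> sets borel" "- A \<in> sets borel" by (simp_all add: borel_comp)
      have "(LINT x:A \<union> - A|lborel. ?f x) = (LINT x:A|lborel. ?f x) + (LINT x:- A|lborel. ?f x)"
        using A by (intro set_integral_Un si) auto
      moreover have "(LINT x:A \<union> - A|lborel. ?f x) = 0"
        using zero unfolding set_lebesgue_integral_def B_def by simp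
      ultimately show ?case using compl.IH by (simp add: Compl_eq_Diff_UNIV)
    next
      case (union F)
      then have F: "\<And>i. F i \<in> sets borel" by (auto simp: borel_eq_box)
      have "(LINT x:(\<Union>i. F i)|lborel. ?f x) = (\<Sum>i. (LINT x:F i|lborel. ?f x))"
        using F union(1) by (intro lebesgue_integral_countable_add si) (auto simp: disjoint_family_on_def)
      then show ?case using union.IH by simp
    qed
  qed
  then have "AE x in lborel. \<forall>N. indicator (B N) x *\<^sub>R f x = 0"
    by (subst AE_all_countable) blast
  then show ?thesis
  proof eventually_elim
    case (elim x)
    have "(\<Union>N. B N) = UNIV" unfolding B_def by (rule UN_box_eq_UNIV)
    then obtain N where "x \<in> B N" by blast
    with elim show ?case by (auto dest: spec[of _ N])
  qed
qed

lemma square_integrable_indicator_box: "square_integrable (\<lambda>x. c * indicator (box l u) x :: complex)"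
proof (rule square_integrable_mult_left)
  have "(cmod (indicator (box l u) x))\<^sup>2 = indicator (box l u) x" for x
    by (auto simp: indicator_def)
  then show "square_integrable (indicator (box l u) :: 'a \<Rightarrow> complex)"
    unfolding square_integrable_def by (auto intro!: integrable_real_indicator emeasure_bounded_finite)
qed

text \<open>The bumps increase to the indicators of boxes and are dominated by them, so orthogonality to
the bumps makes every box integral vanish.\<close>

lemma l2_eq_0_if_orthogonal_test_functions:
  fixes u :: "'a::euclidean_space l2"
  assumes "\<And>\<phi>. \<phi> \<in> test_functions \<Longrightarrow> cinner u (abs_l2 \<phi>) = 0"
  shows "u = 0"
proof -
  obtain f where f: "square_integrable f" "u = abs_l2 f" by (rule l2_obtain_rep)
  then have [measurable]: "f \<in> borel_measurable borel" by (simp add: square_integrable_def)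
  have int: "set_integrable lborel (box l u) f" for l u :: 'a
    using square_integrable_mult_cnj[OF f(1) square_integrable_indicator_box[of 1 l u]]
    unfolding set_integrable_def
    by (rule back_subst[of "integrable lborel"]) (auto simp: indicator_def)
  have "AE x in lborel. f x = 0"
  proof (rule AE_eq_0_of_box_integrals[OF int])
    fix l u :: 'a
    let ?\<phi> = "\<lambda>n x. 1 * complex_of_real (box_bump l u n x)"
    have z: "(LINT x|lborel. f x * cnj (?\<phi> n x)) = 0" for n
      using assms[OF test_functions_box_bump[of 1 l u n]] f
        test_functions_square_integrable[OF test_functions_box_bump[of 1 l u n]]
      by (simp add: cinner.abs_eq)
    have "(\<lambda>n. LINT x|lborel. f x * cnj (?\<phi> n x)) \<longlonglongrightarrow> (LINT x|lborel. indicator (box l u) x *\<^sub>R f x)"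
    proof (rule integral_dominated_convergence)
      show "integrable lborel (\<lambda>x. norm (indicator (box l u) x *\<^sub>R f x))"
        using int unfolding set_integrable_def by (rule integrable_norm)
      show "AE x in lborel. (\<lambda>n. f x * cnj (?\<phi> n x)) \<longlonglongrightarrow> indicator (box l u) x *\<^sub>R f x"
      proof (intro always_eventually allI)
        fix x
        have "(\<lambda>n. box_bump l u n x *\<^sub>R f x) \<longlonglongrightarrow> indicator (box l u) x *\<^sub>R f x"
          by (intro tendsto_intros box_bump_tendsto)
        then show "(\<lambda>n. f x * cnj (?\<phi> n x)) \<longlonglongrightarrow> indicator (box l u) x *\<^sub>R f x"
          by (simp add: scaleR_conv_of_real mult.commute)
      qed
      show "AE x in lborel. norm (f x * cnj (?\<phi> n x)) \<le> norm (indicator (box l u) x *\<^sub>R f x)" for n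
      proof (intro always_eventually allI)
        fix x
        show "norm (f x * cnj (?\<phi> n x)) \<le> norm (indicator (box l u) x *\<^sub>R f x)"
          using box_bump_bounds[of l u n x] box_bump_eq_0[of x l u n]
          by (cases "x \<in> box l u") (auto simp: norm_mult mult_left_le)
      qed
      show "(\<lambda>x. f x * cnj (?\<phi> n x)) \<in> borel_measurable lborel" for n
        using test_functions_square_integrable[OF test_functions_box_bump[of 1 l u n]]
        by (auto simp: square_integrable_def)
    qed simp
    then show "(LINT x:box l u|lborel. f x) = 0"
      unfolding z set_lebesgue_integral_def using LIMSEQ_unique tendsto_const by blast
  qed
  then show ?thesis
    using f abs_l2_eq_iff[OF f(1) square_integrable_zero] by (simp add: zero_l2_def)
qed

section \<open>The complex structure\<close>

lemma cinner_scaleC_left: "cinner (scaleC c u) v = c * cinner u v"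
  by transfer (simp add: mult.assoc)

lemma cinner_scaleC_right: "cinner u (scaleC c v) = cnj c * cinner u v"
proof transfer
  fix c and f g :: "'a \<Rightarrow> complex"
  have "(LINT x|lborel. f x * cnj (c * g x)) = (LINT x|lborel. cnj c * (f x * cnj (g x)))"
    by (intro Bochner_Integration.integral_cong) (auto simp: mult_ac)
  then show "(LINT x|lborel. f x * cnj (c * g x)) = cnj c * (LINT x|lborel. f x * cnj (g x))"
    by simp
qed

text \<open>The complex inner product is determined by the real one. On subspaces that are stable under
multiplication by \<open>\<i>\<close>, real orthogonality therefore implies complex orthogonality, and the
Hilbert space arguments can be carried out with the real inner product alone.\<close>

lemma cinner_eq_inner: "cinner u v = Complex (inner u v) (inner u (scaleC \<i> v))"
  by (simp add: inner_l2_def cinner_scaleC_right complex_eq_iff)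

lemma scaleC_scaleC: "scaleC c (scaleC d u) = scaleC (c * d) u"
  by transfer (auto simp: l2_rel_def mult.assoc intro: square_integrable_mult_left)

lemma scaleC_add_right: "scaleC c (u + v) = scaleC c u + scaleC c v"
  by transfer (auto simp: l2_rel_def distrib_left
    intro!: square_integrable_add square_integrable_mult_left)

lemma scaleC_of_real: "scaleC (complex_of_real r) u = r *\<^sub>R u"
  by (simp add: scaleR_l2_def)

lemma inner_scaleC_i: "inner (scaleC \<i> u) (scaleC \<i> v) = inner u v"
  by (simp add: inner_l2_def cinner_scaleC_left cinner_scaleC_right)

lemma norm_scaleC: "norm (scaleC c u) = cmod c * norm u"
proof (rule power2_eq_imp_eq)
  have "(norm (scaleC c u))\<^sup>2 = Re ((c * cnj c) * cinner u u)"
    by (simp add: power2_norm_eq_inner inner_l2_def cinner_scaleC_left cinner_scaleC_right mult_ac)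
  also have "\<dots> = (cmod c)\<^sup>2 * Re (cinner u u)"
    by (simp flip: complex_norm_square of_real_power)
  finally show "(norm (scaleC c u))\<^sup>2 = (cmod c * norm u)\<^sup>2"
    by (simp add: power_mult_distrib power2_norm_eq_inner inner_l2_def)
qed auto

lemma bounded_linear_scaleC: "bounded_linear (scaleC c)"
proof (rule bounded_linear_intro[where K = "cmod c"])
  show "scaleC c (r *\<^sub>R u) = r *\<^sub>R scaleC c u" for r u
    by (simp add: scaleR_l2_def scaleC_scaleC mult.commute)
qed (simp_all add: scaleC_add_right norm_scaleC mult.commute)

lemma tendsto_cinner:
  assumes "(f \<longlongrightarrow> u) F" "(g \<longlongrightarrow> v) F"
  shows "((\<lambda>x. cinner (f x) (g x)) \<longlongrightarrow> cinner u v) F"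
  unfolding cinner_eq_inner
  by (intro tendsto_Complex tendsto_inner assms bounded_linear.tendsto[OF bounded_linear_scaleC])

section \<open>Multiplication operators\<close>

definition bounded_borel :: "('a::euclidean_space \<Rightarrow> complex) \<Rightarrow> bool" where
  "bounded_borel m \<longleftrightarrow> m \<in> borel_measurable borel \<and> bounded (range m)"

lemma square_integrable_bounded_mult:
  assumes "bounded_borel m" "square_integrable f"
  shows "square_integrable (\<lambda>x. m x * f x)"
proof -
  obtain C where C: "\<And>x. cmod (m x) \<le> C"
    using assms(1) by (auto simp: bounded_borel_def bounded_iff)
  have [measurable]: "f \<in> borel_measurable borel" "m \<in> borel_measurable borel"
    using assms by (auto simp: bounded_borel_def square_integrable_def)
  have "integrable lborel (\<lambda>x. C\<^sup>2 * (cmod (f x))\<^sup>2)"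
    using assms(2) by (simp add: square_integrable_def)
  then have "integrable lborel (\<lambda>x. (cmod (m x * f x))\<^sup>2)"
    by (rule Bochner_Integration.integrable_bound)
      (auto simp: norm_mult power_mult_distrib intro!: mult_right_mono power_mono C)
  then show ?thesis by (simp add: square_integrable_def)
qed

text \<open>Outside the bounded Borel multipliers the operator is set to zero, so that it is total and
respects almost-everywhere equality.\<close>

lift_definition mult_l2 :: "('a::euclidean_space \<Rightarrow> complex) \<Rightarrow> 'a l2 \<Rightarrow> 'a l2" is
  "\<lambda>m f. if bounded_borel m then (\<lambda>x. m x * f x) else (\<lambda>x. 0)"
  by (auto simp: l2_rel_def square_integrable_zero square_integrable_bounded_mult)

lemma mult_l2_abs:
  assumes "bounded_borel m" "square_integrable f"
  shows "mult_l2 m (abs_l2 f) = abs_l2 (\<lambda>x. m x * f x)"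
  using assms by (simp add: mult_l2.abs_eq)

lemma norm_mult_l2_le:
  assumes m: "bounded_borel m" "\<And>x. cmod (m x) \<le> C" "0 \<le> C"
  shows "norm (mult_l2 m u) \<le> C * norm u"
proof -
  obtain f where f: "square_integrable f" "u = abs_l2 f" by (rule l2_obtain_rep)
  have "(norm (mult_l2 m u))\<^sup>2 \<le> (LINT x|lborel. C\<^sup>2 * (cmod (f x))\<^sup>2)"
    unfolding f mult_l2_abs[OF m(1) f(1)] norm_abs_l2_squared[OF square_integrable_bounded_mult[OF m(1) f(1)]]
    using f(1) square_integrable_bounded_mult[OF m(1) f(1)]
    by (intro integral_mono)
      (auto simp: square_integrable_def norm_mult power_mult_distrib intro!: mult_right_mono power_mono m)
  also have "\<dots> = (C * norm u)\<^sup>2"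
    using f by (simp add: norm_abs_l2_squared power_mult_distrib)
  finally show ?thesis using m(3) by (simp add: power2_le_iff_abs_le)
qed

lemma mult_l2_scaleC:
  assumes m: "bounded_borel m"
  shows "mult_l2 m (scaleC c u) = scaleC c (mult_l2 m u)"
proof -
  obtain f where f: "square_integrable f" "u = abs_l2 f" by (rule l2_obtain_rep)
  then show ?thesis
    using m by (simp add: scaleC.abs_eq mult_l2_abs square_integrable_mult_left
        square_integrable_bounded_mult mult.left_commute)
qed

lemma mult_l2_add:
  assumes m: "bounded_borel m"
  shows "mult_l2 m (u + v) = mult_l2 m u + mult_l2 m v"
proof -
  obtain f where f: "square_integrable f" "u = abs_l2 f" by (rule l2_obtain_rep)
  obtain g where g: "square_integrable g" "v = abs_l2 g" by (rule l2_obtain_rep)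
  from f g show ?thesis
    using m by (simp add: plus_l2.abs_eq mult_l2_abs square_integrable_add
        square_integrable_bounded_mult distrib_left)
qed

lemma bounded_linear_mult_l2:
  assumes m: "bounded_borel m"
  shows "bounded_linear (mult_l2 m)"
proof -
  obtain C where C: "\<And>x. cmod (m x) \<le> C" using m by (auto simp: bounded_borel_def bounded_iff)
  then have "0 \<le> C" using norm_ge_zero order_trans by blast
  show ?thesis
    using norm_mult_l2_le[OF m C \<open>0 \<le> C\<close>]
    by (intro bounded_linear_intro[where K = C])
      (simp_all add: mult_l2_add m mult_l2_scaleC scaleR_l2_def mult.commute)
qed

lemma mult_l2_eq_0D:
  assumes m: "bounded_borel m" "\<And>x. m x \<noteq> 0" and "mult_l2 m u = 0"
  shows "u = 0"
proof -
  obtain f where f: "square_integrable f" "u = abs_l2 f" by (rule l2_obtain_rep)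
  have "AE x in lborel. m x * f x = 0"
    using assms(3) f mult_l2_abs[OF m(1) f(1)]
      abs_l2_eq_iff[OF square_integrable_bounded_mult[OF m(1) f(1)] square_integrable_zero]
    by (simp add: zero_l2_def)
  then have "AE x in lborel. f x = 0" using m(2) by simp
  then show ?thesis
    using f abs_l2_eq_iff[OF f(1) square_integrable_zero] by (simp add: zero_l2_def)
qed

lemma bounded_borel_plane_wave: "bounded_borel (plane_wave k)"
proof -
  have "plane_wave k \<in> borel_measurable borel"
    using C_k_plane_wave[of 0 k] by (auto intro: borel_measurable_continuous_onI)
  moreover have "cmod (plane_wave k x) = 1" for x by (simp add: plane_wave_def)
  ultimately show ?thesis by (auto simp: bounded_borel_def bounded_iff)
qed

lemma mod_op_eq_mult_l2: "mod_op k u = mult_l2 (plane_wave k) u"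
proof -
  obtain f where f: "square_integrable f" "u = abs_l2 f" by (rule l2_obtain_rep)
  then show ?thesis
    by (simp add: mod_op.abs_eq mult_l2_abs bounded_borel_plane_wave) (simp add: plane_wave_def)
qed

lemma mult_l2_commute:
  assumes "bounded_borel m" "bounded_borel m'"
  shows "mult_l2 m (mult_l2 m' u) = mult_l2 m' (mult_l2 m u)"
proof -
  obtain f where f: "square_integrable f" "u = abs_l2 f" by (rule l2_obtain_rep)
  then show ?thesis
    using assms by (simp add: mult_l2_abs square_integrable_bounded_mult mult.left_commute)
qed

lemma norm_mod_op: "norm (mod_op k u) = norm u"
  by (simp add: norm_eq_sqrt_inner inner_l2_def mod_op_isometry)

lemma bounded_linear_mod_op: "bounded_linear (mod_op k)"
  unfolding mod_op_eq_mult_l2[abs_def] by (rule bounded_linear_mult_l2[OF bounded_borel_plane_wave])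

section \<open>The closed gradient\<close>

lemma continuous_on_if_C_1: "C_k 1 f \<Longrightarrow> continuous_on UNIV f"
  using C_k_SucD[of 0 f] by simp

lemma partial_deriv_add:
  assumes "f differentiable (at x)" "g differentiable (at x)"
  shows "partial_deriv b (\<lambda>x. f x + g x) x = partial_deriv b f x + partial_deriv b g x"
  using assms by (intro partial_deriv_eqI has_derivative_add has_derivative_partial_deriv)

lemma partial_deriv_scale:
  fixes f :: "'a::euclidean_space \<Rightarrow> complex"
  assumes "f differentiable (at x)"
  shows "partial_deriv b (\<lambda>x. c * f x) x = c * partial_deriv b f x"
  using assms by (intro partial_deriv_eqI has_derivative_mult_right has_derivative_partial_deriv)

definition scaleC_vec :: "complex \<Rightarrow> ('a::euclidean_space l2)^'n \<Rightarrow> 'a l2^'n" where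
  "scaleC_vec c V = (\<chi> i. scaleC c (V $ i))"

locale elliptic_coefficient =
  fixes a :: "real^'n \<Rightarrow> real" and c :: real
  assumes pos: "0 < a x" and le: "a x \<le> c" and C1: "C_k 1 a"
begin

definition root_a :: "real^'n \<Rightarrow> complex" where
  "root_a x = complex_of_real (sqrt (a x))"

lemma cont_a: "continuous_on UNIV a"
  using C1 by (rule continuous_on_if_C_1)

lemma c_nonneg: "0 \<le> c"
  using pos[of undefined] le[of undefined] by linarith

lemma norm_root_a_le: "cmod (root_a x) \<le> sqrt c"
  using pos[of x] le[of x] by (simp add: root_a_def)

lemma bounded_borel_root_a: "bounded_borel root_a"
proof -
  have "continuous_on UNIV root_a"
    unfolding root_a_def by (intro continuous_intros cont_a)
  then show ?thesis
    using norm_root_a_le by (auto simp: bounded_borel_def bounded_iff intro: borel_measurable_continuous_onI)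
qed

lemma root_a_neq_0: "root_a x \<noteq> 0"
  using pos[of x] by (simp add: root_a_def)

lemma root_a_squared: "root_a x * root_a x = complex_of_real (a x)"
  using pos[of x] by (simp add: root_a_def flip: of_real_mult)

abbreviation "M \<equiv> mult_l2 root_a"

text \<open>The gradient weighted with \<open>\<surd>a\<close>: the weight turns the energy into the squared norm of a vector of
\<open>L\<^sup>2\<close> functions, so that all forms become inner products in a Hilbert space.\<close>

definition grad :: "(real^'n \<Rightarrow> complex) \<Rightarrow> (real^'n) l2^'n" where
  "grad \<phi> = (\<chi> i. M (abs_l2 (partial_deriv (axis i 1) \<phi>)))"

definition test_graph :: "((real^'n) l2 \<times> ((real^'n) l2^'n)) set" where
  "test_graph = (\<lambda>\<phi>. (abs_l2 \<phi>, grad \<phi>)) ` test_functions"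

text \<open>The domain of the closed form is the set of first components of this closure, and the form is
the inner product of the second components.\<close>

definition grad_graph :: "((real^'n) l2 \<times> ((real^'n) l2^'n)) set" where
  "grad_graph = closure test_graph"

lemma test_functions_partial_deriv_axis:
  "\<phi> \<in> test_functions \<Longrightarrow> partial_deriv (axis i 1 :: real^'n) \<phi> \<in> test_functions"
  by (rule test_functions_partial_deriv) (auto simp: axis_in_Basis_iff Basis_real_def)

lemma si_partial_deriv:
  "\<phi> \<in> test_functions \<Longrightarrow> square_integrable (partial_deriv (axis i 1 :: real^'n) \<phi>)"
  by (intro test_functions_square_integrable test_functions_partial_deriv_axis)

lemma grad_add:
  assumes "\<phi> \<in> test_functions" "\<psi> \<in> test_functions"
  shows "grad (\<lambda>x. \<phi> x + \<psi> x) = grad \<phi> + grad \<psi>"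
proof -
  have "partial_deriv b (\<lambda>x. \<phi> x + \<psi> x) = (\<lambda>x. partial_deriv b \<phi> x + partial_deriv b \<psi> x)" for b
    using assms by (auto simp: partial_deriv_add test_functions_differentiable)
  then show ?thesis
    using assms by (simp add: grad_def vec_eq_iff plus_l2.abs_eq[symmetric] si_partial_deriv
        mult_l2_add[OF bounded_borel_root_a])
qed

lemma grad_scale:
  assumes "\<phi> \<in> test_functions"
  shows "grad (\<lambda>x. z * \<phi> x) = scaleC_vec z (grad \<phi>)"
proof -
  have "partial_deriv b (\<lambda>x. z * \<phi> x) = (\<lambda>x. z * partial_deriv b \<phi> x)" for b
    using assms by (auto simp: partial_deriv_scale test_functions_differentiable)
  then show ?thesis
    using assms by (simp add: grad_def vec_eq_iff scaleC.abs_eq[symmetric] si_partial_deriv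
        mult_l2_scaleC[OF bounded_borel_root_a] scaleC_vec_def)
qed

lemma abs_l2_add_test:
  "\<phi> \<in> test_functions \<Longrightarrow> \<psi> \<in> test_functions \<Longrightarrow> abs_l2 (\<lambda>x. \<phi> x + \<psi> x) = abs_l2 \<phi> + abs_l2 \<psi>"
  by (simp add: plus_l2.abs_eq test_functions_square_integrable)

lemma abs_l2_scale_test:
  "\<phi> \<in> test_functions \<Longrightarrow> abs_l2 (\<lambda>x. z * \<phi> x) = scaleC z (abs_l2 \<phi>)"
  by (simp add: scaleC.abs_eq test_functions_square_integrable)

lemma test_graph_scaleC:
  assumes "p \<in> test_graph"
  shows "(scaleC z (fst p), scaleC_vec z (snd p)) \<in> test_graph"
proof -
  obtain \<phi> where \<phi>: "\<phi> \<in> test_functions" "p = (abs_l2 \<phi>, grad \<phi>)"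
    using assms by (auto simp: test_graph_def)
  then show ?thesis
    unfolding test_graph_def
    by (intro image_eqI[OF _ test_functions_scale[of \<phi> z]]) (auto simp: grad_scale abs_l2_scale_test)
qed

lemma scaleC_vec_of_real: "scaleC_vec (complex_of_real r) V = r *\<^sub>R V"
  by (simp add: scaleC_vec_def vec_eq_iff scaleC_of_real)

lemma subspace_grad_graph: "subspace grad_graph"
  unfolding grad_graph_def
proof (rule subspace_closure, rule subspaceI)
  show "r *\<^sub>R p \<in> test_graph" if "p \<in> test_graph" for p r
    using test_graph_scaleC[OF that, of "complex_of_real r"]
    by (simp add: scaleC_vec_of_real scaleC_of_real scaleR_prod_def)
  show "p + q \<in> test_graph" if pq: "p \<in> test_graph" "q \<in> test_graph" for p q
  proof -
    obtain \<phi> \<psi> where "\<phi> \<in> test_functions" "p = (abs_l2 \<phi>, grad \<phi>)"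
        "\<psi> \<in> test_functions" "q = (abs_l2 \<psi>, grad \<psi>)"
      using pq unfolding test_graph_def by blast
    then show ?thesis
      unfolding test_graph_def
      by (intro image_eqI[OF _ test_functions_add[of \<phi> \<psi>]]) (auto simp: grad_add abs_l2_add_test)
  qed
  have "(\<lambda>x. 0) \<in> test_functions"
    using test_functions_box_bump[of 0 0 0 0] by simp
  then obtain p where "p \<in> test_graph" by (auto simp: test_graph_def)
  from test_graph_scaleC[OF this, of "complex_of_real 0"] show "0 \<in> test_graph"
    unfolding scaleC_vec_of_real scaleC_of_real by (simp add: zero_prod_def)
qed

lemma closed_grad_graph: "closed grad_graph"
  by (simp add: grad_graph_def)

text \<open>A continuous map that preserves the graph over test functions preserves its closure, so symmetries
of the closed gradient need only be computed for classical derivatives.\<close>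

lemma grad_graph_invariant:
  assumes "continuous_on UNIV F" "\<And>p. p \<in> test_graph \<Longrightarrow> F p \<in> test_graph" "p \<in> grad_graph"
  shows "F p \<in> grad_graph"
proof -
  have "F ` closure test_graph \<subseteq> closure test_graph"
  proof (rule image_closure_subset)
    show "continuous_on (closure test_graph) F" using assms(1) by (rule continuous_on_subset) simp
    show "F ` test_graph \<subseteq> closure test_graph" using assms(2) closure_subset by blast
  qed simp
  then show ?thesis using assms(3) by (auto simp: grad_graph_def)
qed

lemma grad_graph_scaleC:
  assumes "(v, V) \<in> grad_graph"
  shows "(scaleC z v, scaleC_vec z V) \<in> grad_graph"
proof -
  have "continuous_on UNIV (\<lambda>p. (scaleC z (fst p), scaleC_vec z (snd p)) :: (real^'n) l2 \<times> ((real^'n) l2^'n))"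
    unfolding scaleC_vec_def
    by (intro continuous_intros bounded_linear.continuous_on[OF bounded_linear_scaleC])
  from grad_graph_invariant[OF this test_graph_scaleC assms] show ?thesis by simp
qed

lemma partial_deriv_plane_wave_mult:
  assumes "\<phi> \<in> test_functions"
  shows "partial_deriv (axis i 1) (\<lambda>x. plane_wave k x * \<phi> x) x
    = plane_wave k x * partial_deriv (axis i 1) \<phi> x + (\<i> * complex_of_real (k $ i)) * (plane_wave k x * \<phi> x)"
proof -
  have "plane_wave k differentiable (at x)"
    using has_derivative_plane_wave unfolding differentiable_def by blast
  then show ?thesis
    using test_functions_differentiable[OF assms]
    by (simp add: partial_deriv_mult partial_deriv_plane_wave inner_axis mult_ac)
qed

text \<open>Conjugation with a plane wave shifts the gradient by a zeroth-order term. In the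
weighted gradient this term contains the factor \<open>\<surd>a\<close>; because \<open>a\<close> is bounded, it depends continuously
on \<open>u\<close> alone, so the formula extends from test functions to the closure.\<close>

lemma grad_graph_mod_op:
  assumes "(u, U) \<in> grad_graph"
  shows "(mod_op k u, \<chi> i. mod_op k (U $ i) + scaleC (\<i> * complex_of_real (k $ i)) (M (mod_op k u)))
    \<in> grad_graph"
proof -
  define F where "F p = (mod_op k (fst p), \<chi> i. mod_op k (snd p $ i)
      + scaleC (\<i> * complex_of_real (k $ i)) (M (mod_op k (fst p))))"
    for p :: "(real^'n) l2 \<times> ((real^'n) l2^'n)"
  have "F (u, U) \<in> grad_graph"
  proof (rule grad_graph_invariant[OF _ _ assms])
    show "continuous_on UNIV F"
      unfolding F_def
      by (intro continuous_intros bounded_linear.continuous_on[OF bounded_linear_scaleC]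
          bounded_linear.continuous_on[OF bounded_linear_mod_op]
          bounded_linear.continuous_on[OF bounded_linear_mult_l2[OF bounded_borel_root_a]])
  next
    fix p assume "p \<in> test_graph"
    then obtain \<phi> where \<phi>: "\<phi> \<in> test_functions" "p = (abs_l2 \<phi>, grad \<phi>)"
      by (auto simp: test_graph_def)
    let ?\<psi> = "\<lambda>x. plane_wave k x * \<phi> x"
    have \<psi>: "?\<psi> \<in> test_functions"
      using C_k_plane_wave \<phi>(1) by (rule test_functions_smooth_mult)
    have 1: "mod_op k (abs_l2 \<phi>) = abs_l2 ?\<psi>"
      using \<phi>(1) by (simp add: mod_op_eq_mult_l2 mult_l2_abs bounded_borel_plane_wave
          test_functions_square_integrable)
    have "grad ?\<psi> $ i = mod_op k (grad \<phi> $ i) + scaleC (\<i> * complex_of_real (k $ i)) (M (abs_l2 ?\<psi>))" for i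
    proof -
      have si: "square_integrable (\<lambda>x. plane_wave k x * partial_deriv (axis i 1) \<phi> x)"
        by (intro square_integrable_bounded_mult bounded_borel_plane_wave si_partial_deriv \<phi>)
      have "abs_l2 (partial_deriv (axis i 1) ?\<psi>)
        = mod_op k (abs_l2 (partial_deriv (axis i 1) \<phi>)) + scaleC (\<i> * complex_of_real (k $ i)) (abs_l2 ?\<psi>)"
        unfolding partial_deriv_plane_wave_mult[OF \<phi>(1), abs_def]
        using \<phi>(1) si \<psi>
        by (simp add: mod_op_eq_mult_l2 mult_l2_abs bounded_borel_plane_wave si_partial_deriv
          scaleC.abs_eq plus_l2.abs_eq square_integrable_mult_left test_functions_square_integrable)
      then show ?thesis
        by (simp add: grad_def mult_l2_add mult_l2_scaleC mod_op_eq_mult_l2 bounded_borel_root_a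
          mult_l2_commute[OF bounded_borel_root_a bounded_borel_plane_wave])
    qed
    then have "F p = (abs_l2 ?\<psi>, grad ?\<psi>)"
      by (simp add: F_def \<phi>(2) 1 vec_eq_iff)
    then show "F p \<in> test_graph" using \<psi> by (auto simp: test_graph_def)
  qed
  then show ?thesis by (simp add: F_def)
qed

text \<open>Integrating \<open>\<partial>\<^sub>i (\<phi> a cnj \<psi>)\<close> moves the derivative from \<open>\<phi>\<close> to \<open>a \<psi>\<close>. The witness is
\<open>\<partial>\<^sub>i (a \<psi>)\<close>, which is continuous with compact support because \<open>a\<close> is continuously differentiable.\<close>

lemma grad_form_by_parts:
  assumes "\<psi> \<in> test_functions"
  shows "\<exists>w. \<forall>\<phi>\<in>test_functions. cinner (M (grad \<phi> $ i)) (abs_l2 \<psi>) = - cinner (abs_l2 \<phi>) w"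
proof -
  define b where "b = (axis i 1 :: real^'n)"
  have b: "b \<in> Basis" by (auto simp: b_def axis_in_Basis_iff Basis_real_def)
  define \<eta> where "\<eta> x = complex_of_real (a x) * \<psi> x" for x
  obtain K where K: "compact K" "\<And>x. x \<notin> K \<Longrightarrow> \<psi> x = 0"
    using test_functions_compact_support[OF assms] by blast
  have \<eta>1: "C_k 1 \<eta>"
    unfolding \<eta>_def
    by (intro C_k_mult C_k_bounded_linear[OF bounded_linear_of_real C1] test_functions_C_k assms)
  then have \<eta>d: "\<eta> differentiable (at x)" for x unfolding C_1_iff by blast
  define \<eta>' where "\<eta>' = partial_deriv b \<eta>"
  have \<eta>K: "x \<notin> K \<Longrightarrow> \<eta> x = 0" for x using K by (simp add: \<eta>_def)
  have cont: "continuous_on UNIV \<eta>'" using \<eta>1 b unfolding C_1_iff \<eta>'_def by blast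
  have si\<eta>': "square_integrable \<eta>'"
    unfolding square_integrable_def
  proof
    show "\<eta>' \<in> borel_measurable lborel" using cont by (simp add: borel_measurable_continuous_onI)
    have "\<eta>' x = 0" if "x \<notin> K" for x
      unfolding \<eta>'_def by (rule partial_deriv_eq_0_outside[of K \<eta>]) (use that K \<eta>K in auto)
    then show "integrable lborel (\<lambda>x. (cmod (\<eta>' x))\<^sup>2)"
      by (intro integrable_continuous_compact_support[of _ K] continuous_intros cont K) auto
  qed
  have "cinner (M (grad \<phi> $ i)) (abs_l2 \<psi>) = - cinner (abs_l2 \<phi>) (abs_l2 \<eta>')"
    if \<phi>: "\<phi> \<in> test_functions" for \<phi>
  proof -
    have si: "square_integrable \<phi>" "square_integrable \<psi>" "square_integrable (partial_deriv b \<phi>)"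
      using \<phi> assms by (auto intro: test_functions_square_integrable si_partial_deriv simp: b_def)
    have sr: "square_integrable (\<lambda>x. root_a x * (root_a x * partial_deriv b \<phi> x))"
      by (intro square_integrable_bounded_mult bounded_borel_root_a si)
    then have sa: "square_integrable (\<lambda>x. complex_of_real (a x) * partial_deriv b \<phi> x)"
      by (simp add: root_a_squared flip: mult.assoc)
    have "M (grad \<phi> $ i) = abs_l2 (\<lambda>x. complex_of_real (a x) * partial_deriv b \<phi> x)"
      using si by (simp add: grad_def b_def[symmetric] mult_l2_abs bounded_borel_root_a
          square_integrable_bounded_mult root_a_squared flip: mult.assoc)
    then have 1: "cinner (M (grad \<phi> $ i)) (abs_l2 \<psi>)
        = (LINT x|lborel. complex_of_real (a x) * partial_deriv b \<phi> x * cnj (\<psi> x))"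
      using si sa by (simp add: cinner.abs_eq)
    have 2: "cinner (abs_l2 \<phi>) (abs_l2 \<eta>') = (LINT x|lborel. \<phi> x * cnj (\<eta>' x))"
      using si si\<eta>' by (simp add: cinner.abs_eq)
    have D: "partial_deriv b (\<lambda>x. \<phi> x * cnj (\<eta> x)) x
        = \<phi> x * cnj (\<eta>' x) + complex_of_real (a x) * partial_deriv b \<phi> x * cnj (\<psi> x)" for x
    proof -
      have "((\<lambda>x. cnj (\<eta> x)) has_derivative (\<lambda>b. cnj (partial_deriv b \<eta> x))) (at x)"
        by (rule bounded_linear.has_derivative[OF bounded_linear_cnj has_derivative_partial_deriv[OF \<eta>d]])
      from partial_deriv_eqI[OF has_derivative_mult[OF
            has_derivative_partial_deriv[OF test_functions_differentiable[OF \<phi>]] this]]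
      show ?thesis by (simp add: \<eta>'_def \<eta>_def mult_ac)
    qed
    have "(LINT x|lborel. partial_deriv b (\<lambda>x. \<phi> x * cnj (\<eta> x)) x) = 0"
    proof (rule integral_partial_deriv_eq_0[OF _ K(1) _ b])
      show "C_k 1 (\<lambda>x. \<phi> x * cnj (\<eta> x))"
        by (intro C_k_mult test_functions_C_k \<phi> C_k_bounded_linear[OF bounded_linear_cnj \<eta>1])
    qed (use \<eta>K in auto)
    then have "(LINT x|lborel. \<phi> x * cnj (\<eta>' x))
        + (LINT x|lborel. complex_of_real (a x) * partial_deriv b \<phi> x * cnj (\<psi> x)) = 0"
      unfolding D using square_integrable_mult_cnj[OF si(1) si\<eta>'] square_integrable_mult_cnj[OF sa si(2)]
      by simp
    then show ?thesis unfolding 1 2 by (simp add: eq_neg_iff_add_eq_0 add.commute)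
  qed
  then show ?thesis by blast
qed

lemma grad_graph_sequence:
  assumes "(u, U) \<in> grad_graph"
  obtains \<phi> where "\<And>n. \<phi> n \<in> test_functions" "(\<lambda>n. abs_l2 (\<phi> n)) \<longlonglongrightarrow> u" "(\<lambda>n. grad (\<phi> n)) \<longlonglongrightarrow> U"
proof -
  obtain P where P: "\<And>n. P n \<in> test_graph" "P \<longlonglongrightarrow> (u, U)"
    using assms unfolding grad_graph_def closure_sequential by blast
  then have "\<exists>\<phi>. \<phi> \<in> test_functions \<and> P n = (abs_l2 \<phi>, grad \<phi>)" for n
    by (auto simp: test_graph_def)
  then obtain \<phi> where \<phi>: "\<And>n. \<phi> n \<in> test_functions" "\<And>n. P n = (abs_l2 (\<phi> n), grad (\<phi> n))"
    by metis
  show ?thesis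
  proof (rule that[of \<phi>])
    show "(\<lambda>n. abs_l2 (\<phi> n)) \<longlonglongrightarrow> u" using tendsto_fst[OF P(2)] by (simp add: \<phi>)
    show "(\<lambda>n. grad (\<phi> n)) \<longlonglongrightarrow> U" using tendsto_snd[OF P(2)] by (simp add: \<phi>)
  qed (rule \<phi>)
qed

text \<open>Closability of the form. If \<open>\<phi>\<^sub>n \<rightarrow> 0\<close> and the weighted gradients converge to \<open>U\<close>, integration by
parts shows that \<open>\<surd>a U\<close> is orthogonal to all test functions.\<close>

lemma grad_graph_closable:
  assumes "(0, U) \<in> grad_graph"
  shows "U = 0"
proof -
  obtain \<phi> where \<phi>: "\<And>n. \<phi> n \<in> test_functions" "(\<lambda>n. abs_l2 (\<phi> n)) \<longlonglongrightarrow> 0" "(\<lambda>n. grad (\<phi> n)) \<longlonglongrightarrow> U"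
    using grad_graph_sequence[OF assms] by blast
  have "U $ i = 0" for i
  proof (rule mult_l2_eq_0D[OF bounded_borel_root_a root_a_neq_0], rule l2_eq_0_if_orthogonal_test_functions)
    fix \<psi> :: "real^'n \<Rightarrow> complex" assume "\<psi> \<in> test_functions"
    then obtain w where w: "\<And>\<phi>. \<phi> \<in> test_functions \<Longrightarrow>
        cinner (M (grad \<phi> $ i)) (abs_l2 \<psi>) = - cinner (abs_l2 \<phi>) w"
      using grad_form_by_parts by blast
    have "(\<lambda>n. cinner (M (grad (\<phi> n) $ i)) (abs_l2 \<psi>)) \<longlonglongrightarrow> cinner (M (U $ i)) (abs_l2 \<psi>)"
      by (intro tendsto_cinner bounded_linear.tendsto[OF bounded_linear_mult_l2[OF bounded_borel_root_a]]
          tendsto_vec_nth \<phi> tendsto_const)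
    moreover have "(\<lambda>n. - cinner (abs_l2 (\<phi> n)) w) \<longlonglongrightarrow> - cinner 0 w"
      by (intro tendsto_minus tendsto_cinner \<phi> tendsto_const)
    moreover have "cinner 0 w = 0" by (simp add: cinner_eq_inner complex_eq_iff)
    ultimately show "cinner (M (U $ i)) (abs_l2 \<psi>) = 0"
      unfolding w[OF \<phi>(1)] using LIMSEQ_unique by fastforce
  qed
  then show ?thesis by (simp add: vec_eq_iff)
qed

lemma grad_graph_unique:
  assumes "(u, U) \<in> grad_graph" "(u, U') \<in> grad_graph"
  shows "U = U'"
  using grad_graph_closable[of "U - U'"] subspace_diff[OF subspace_grad_graph assms] by simp

end

section \<open>The closed form and its operator\<close>

lemma norm_vec_squared: "(norm (V :: 'b::real_inner ^ 'n))\<^sup>2 = (\<Sum>i\<in>UNIV. (norm (V $ i))\<^sup>2)"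
  by (simp add: power2_norm_eq_inner inner_vec_def)

lemma sum_Basis_real_vec: "(\<Sum>b\<in>Basis. f b) = (\<Sum>i\<in>UNIV. f (axis i (1::real)))"
  for f :: "real^'n \<Rightarrow> 'b::comm_monoid_add"
proof -
  have B: "(Basis :: (real^'n) set) = range (\<lambda>i. axis i 1)" by (auto simp: Basis_vec_def)
  have "inj (\<lambda>i::'n. axis i (1::real))" by (simp add: inj_on_def axis_eq_axis)
  from sum.reindex[OF this, of f] show ?thesis unfolding B o_def .
qed

definition cinner_vec :: "('a::euclidean_space l2)^'n \<Rightarrow> 'a l2^'n \<Rightarrow> complex" where
  "cinner_vec U V = (\<Sum>i\<in>UNIV. cinner (U $ i) (V $ i))"

lemma cinner_vec_eq_inner: "cinner_vec U V = Complex (inner U V) (inner U (scaleC_vec \<i> V))"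
  by (simp add: cinner_vec_def cinner_eq_inner inner_vec_def scaleC_vec_def complex_eq_iff)

lemma cinner_vec_self: "cinner_vec U U = complex_of_real ((norm U)\<^sup>2)"
proof -
  have "inner u (scaleC \<i> u) = 0" for u :: "'a l2"
    using cinner_scaleC_right[of u \<i> u] inner_scaleC_i[of u u] inner_commute[of u "scaleC \<i> u"]
    by (simp add: inner_l2_def cinner_scaleC_left)
  then show ?thesis
    by (simp add: cinner_vec_eq_inner complex_eq_iff power2_norm_eq_inner inner_vec_def scaleC_vec_def)
qed

lemma tendsto_cinner_vec:
  assumes "(f \<longlongrightarrow> U) F" "(g \<longlongrightarrow> V) F"
  shows "((\<lambda>x. cinner_vec (f x) (g x)) \<longlongrightarrow> cinner_vec U V) F"
  unfolding cinner_vec_def by (intro tendsto_sum tendsto_cinner tendsto_vec_nth assms)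

context elliptic_coefficient
begin

lemma energy_form_eq_cinner_grad:
  assumes "\<phi> \<in> test_functions" "\<psi> \<in> test_functions"
  shows "energy_form a \<phi> \<psi> = cinner_vec (grad \<phi>) (grad \<psi>)"
proof -
  have si: "square_integrable (\<lambda>x. root_a x * partial_deriv (axis i 1 :: real^'n) f x)"
    if "f \<in> test_functions" for f i
    using that by (intro square_integrable_bounded_mult bounded_borel_root_a si_partial_deriv)
  have "energy_form a \<phi> \<psi> = (LINT x|lborel. (\<Sum>i\<in>UNIV.
      (root_a x * partial_deriv (axis i 1) \<phi> x) * cnj (root_a x * partial_deriv (axis i 1) \<psi> x)))"
    unfolding energy_form_def
  proof (intro Bochner_Integration.integral_cong refl)
    fix x
    have "complex_of_real (a x) * (p * cnj q) = root_a x * p * cnj (root_a x * q)" for p q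
    proof -
      have "root_a x * p * cnj (root_a x * q) = (root_a x * root_a x) * (p * cnj q)"
        by (simp add: root_a_def mult_ac)
      then show ?thesis unfolding root_a_squared by (rule sym)
    qed
    then show "complex_of_real (a x) * (\<Sum>b\<in>Basis. partial_deriv b \<phi> x * cnj (partial_deriv b \<psi> x))
      = (\<Sum>i\<in>UNIV. (root_a x * partial_deriv (axis i 1) \<phi> x) * cnj (root_a x * partial_deriv (axis i 1) \<psi> x))"
      by (simp only: sum_Basis_real_vec sum_distrib_left)
  qed
  also have "\<dots> = (\<Sum>i\<in>UNIV. (LINT x|lborel.
      (root_a x * partial_deriv (axis i 1) \<phi> x) * cnj (root_a x * partial_deriv (axis i 1) \<psi> x)))"
    by (intro Bochner_Integration.integral_sum square_integrable_mult_cnj si assms)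
  also have "\<dots> = cinner_vec (grad \<phi>) (grad \<psi>)"
    using assms by (simp add: cinner_vec_def grad_def mult_l2_abs[OF bounded_borel_root_a] si_partial_deriv
        cinner.abs_eq si)
  finally show ?thesis .
qed

lemma energy_eq_norm_grad:
  assumes "\<phi> \<in> test_functions"
  shows "energy a \<phi> = (norm (grad \<phi>))\<^sup>2"
  using energy_form_eq_cinner_grad[OF assms assms] unfolding energy_form_diag cinner_vec_self of_real_eq_iff .

lemma grad_diff:
  assumes "\<phi> \<in> test_functions" "\<psi> \<in> test_functions"
  shows "grad (\<lambda>x. \<phi> x - \<psi> x) = grad \<phi> - grad \<psi>"
  using grad_add[OF test_functions_diff[OF assms] assms(2)] by simp

text \<open>Convergence of the form is convergence in \<open>L\<^sup>2\<close> together with the Cauchy property of the weighted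
gradients, so by completeness it is convergence in the graph of the gradient.\<close>

lemma form_converges_iff:
  "form_converges a \<phi> u \<longleftrightarrow>
     (\<forall>n. \<phi> n \<in> test_functions) \<and> (\<lambda>n. abs_l2 (\<phi> n)) \<longlonglongrightarrow> u \<and> Cauchy (\<lambda>n. grad (\<phi> n))"
proof (cases "\<forall>n. \<phi> n \<in> test_functions")
  case True
  then have *: "energy a (\<lambda>x. \<phi> m x - \<phi> n x) = (norm (grad (\<phi> m) - grad (\<phi> n)))\<^sup>2" for m n
    by (simp add: energy_eq_norm_grad test_functions_diff grad_diff)
  have "(\<forall>e>0. \<exists>M. \<forall>m\<ge>M. \<forall>n\<ge>M. (norm (grad (\<phi> m) - grad (\<phi> n)))\<^sup>2 < e) \<longleftrightarrow> Cauchy (\<lambda>n. grad (\<phi> n))"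
    (is "?L \<longleftrightarrow> _")
  proof
    assume L: ?L
    show "Cauchy (\<lambda>n. grad (\<phi> n))"
    proof (rule CauchyI)
      fix e :: real assume "0 < e"
      then obtain M where "\<forall>m\<ge>M. \<forall>n\<ge>M. (norm (grad (\<phi> m) - grad (\<phi> n)))\<^sup>2 < e\<^sup>2"
        using L by (meson zero_less_power)
      with \<open>0 < e\<close> show "\<exists>M. \<forall>m\<ge>M. \<forall>n\<ge>M. norm (grad (\<phi> m) - grad (\<phi> n)) < e"
        by (meson power_less_imp_less_base less_imp_le)
    qed
  next
    assume C: "Cauchy (\<lambda>n. grad (\<phi> n))"
    show ?L
    proof (intro allI impI)
      fix e :: real assume "0 < e"
      then obtain M where M: "\<forall>m\<ge>M. \<forall>n\<ge>M. norm (grad (\<phi> m) - grad (\<phi> n)) < sqrt e"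
        using C unfolding Cauchy_iff by (meson real_sqrt_gt_zero)
      have "(norm (grad (\<phi> m) - grad (\<phi> n)))\<^sup>2 < e" if "m \<ge> M" "n \<ge> M" for m n
        using M that \<open>0 < e\<close> power_strict_mono[of "norm (grad (\<phi> m) - grad (\<phi> n))" "sqrt e" 2] by simp
      then show "\<exists>M. \<forall>m\<ge>M. \<forall>n\<ge>M. (norm (grad (\<phi> m) - grad (\<phi> n)))\<^sup>2 < e" by blast
    qed
  qed
  with True show ?thesis by (simp add: form_converges_def *)
qed (auto simp: form_converges_def)

lemma form_converges_grad_graph:
  assumes "form_converges a \<phi> u"
  shows "\<exists>U. (u, U) \<in> grad_graph \<and> (\<lambda>n. grad (\<phi> n)) \<longlonglongrightarrow> U"
proof -
  have \<phi>: "\<And>n. \<phi> n \<in> test_functions" "(\<lambda>n. abs_l2 (\<phi> n)) \<longlonglongrightarrow> u" "Cauchy (\<lambda>n. grad (\<phi> n))"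
    using assms by (auto simp: form_converges_iff)
  then obtain U where U: "(\<lambda>n. grad (\<phi> n)) \<longlonglongrightarrow> U"
    using Cauchy_convergent_iff convergent_def by metis
  have "(\<lambda>n. (abs_l2 (\<phi> n), grad (\<phi> n))) \<longlonglongrightarrow> (u, U)"
    by (intro tendsto_Pair \<phi> U)
  moreover have "(abs_l2 (\<phi> n), grad (\<phi> n)) \<in> test_graph" for n
    using \<phi>(1) by (auto simp: test_graph_def)
  ultimately have "(u, U) \<in> grad_graph"
    unfolding grad_graph_def closure_sequential
    by (intro exI[of _ "\<lambda>n. (abs_l2 (\<phi> n), grad (\<phi> n))"]) blast
  with U show ?thesis by blast
qed

lemma grad_graph_form_converges:
  assumes "(u, U) \<in> grad_graph"
  shows "\<exists>\<phi>. form_converges a \<phi> u \<and> (\<lambda>n. grad (\<phi> n)) \<longlonglongrightarrow> U"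
  using grad_graph_sequence[OF assms]
  by (metis form_converges_iff LIMSEQ_imp_Cauchy)

lemma closed_form_dom_iff: "u \<in> closed_form_dom a \<longleftrightarrow> (\<exists>U. (u, U) \<in> grad_graph)"
  unfolding closed_form_dom_def
  using form_converges_grad_graph grad_graph_form_converges by blast

text \<open>Uniqueness of the gradient component makes the limit independent of the approximating
sequences, which is what the definite description in the definition of the form requires.\<close>

lemma closed_form_eq_cinner:
  assumes "(u, U) \<in> grad_graph" "(v, V) \<in> grad_graph"
  shows "closed_form a u v = cinner_vec U V"
  unfolding closed_form_def
proof (rule the_equality)
  have lim: "(\<lambda>n. energy_form a (\<phi> n) (\<psi> n)) \<longlonglongrightarrow> cinner_vec U V"
    if "form_converges a \<phi> u" "form_converges a \<psi> v" for \<phi> \<psi>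
  proof -
    have "(\<lambda>n. grad (\<phi> n)) \<longlonglongrightarrow> U" "(\<lambda>n. grad (\<psi> n)) \<longlonglongrightarrow> V"
      using form_converges_grad_graph[OF that(1)] form_converges_grad_graph[OF that(2)]
        grad_graph_unique assms by blast+
    moreover have "energy_form a (\<phi> n) (\<psi> n) = cinner_vec (grad (\<phi> n)) (grad (\<psi> n))" for n
      using that by (simp add: form_converges_iff energy_form_eq_cinner_grad)
    ultimately show ?thesis by (simp add: tendsto_cinner_vec)
  qed
  then show "\<forall>\<phi> \<psi>. form_converges a \<phi> u \<longrightarrow> form_converges a \<psi> v \<longrightarrow>
      (\<lambda>n. energy_form a (\<phi> n) (\<psi> n)) \<longlonglongrightarrow> cinner_vec U V" by blast
  obtain \<phi> \<psi> where "form_converges a \<phi> u" "form_converges a \<psi> v"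
    using grad_graph_form_converges assms by blast
  then show "w = cinner_vec U V" if "\<forall>\<phi> \<psi>. form_converges a \<phi> u \<longrightarrow> form_converges a \<psi> v \<longrightarrow>
      (\<lambda>n. energy_form a (\<phi> n) (\<psi> n)) \<longlonglongrightarrow> w" for w
    using that lim LIMSEQ_unique by blast
qed

abbreviation "H \<equiv> friedrichs a"

text \<open>The operator is \<open>G\<^sup>* G\<close> for the closed weighted gradient \<open>G\<close>. Only real inner products occur,
because the graph is stable under multiplication by \<open>\<i>\<close>.\<close>

lemma friedrichs_iff:
  "(u, w) \<in> H \<longleftrightarrow>
     (\<exists>U. (u, U) \<in> grad_graph \<and> (\<forall>v V. (v, V) \<in> grad_graph \<longrightarrow> inner U V = inner w v))"
proof
  assume L: "(u, w) \<in> H"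
  then obtain U where U: "(u, U) \<in> grad_graph"
    by (auto simp: friedrichs_def closed_form_dom_iff)
  have "inner U V = inner w v" if V: "(v, V) \<in> grad_graph" for v V
  proof -
    have "v \<in> closed_form_dom a" using V by (auto simp: closed_form_dom_iff)
    then have "closed_form a u v = cinner w v" using L by (simp add: friedrichs_def)
    then show ?thesis
      unfolding closed_form_eq_cinner[OF U V] cinner_vec_eq_inner cinner_eq_inner by simp
  qed
  with U show "\<exists>U. (u, U) \<in> grad_graph \<and> (\<forall>v V. (v, V) \<in> grad_graph \<longrightarrow> inner U V = inner w v)"
    by blast
next
  assume "\<exists>U. (u, U) \<in> grad_graph \<and> (\<forall>v V. (v, V) \<in> grad_graph \<longrightarrow> inner U V = inner w v)"
  then obtain U where U: "(u, U) \<in> grad_graph"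
    and eq: "\<And>v V. (v, V) \<in> grad_graph \<Longrightarrow> inner U V = inner w v" by blast
  have "closed_form a u v = cinner w v" if "(v, V) \<in> grad_graph" for v V
    using eq[OF that] eq[OF grad_graph_scaleC[OF that, of \<i>]] closed_form_eq_cinner[OF U that]
    by (simp add: cinner_vec_eq_inner cinner_eq_inner)
  with U show "(u, w) \<in> H" by (auto simp: friedrichs_def closed_form_dom_iff)
qed

lemma subspace_friedrichs: "subspace H"
proof (rule subspaceI)
  have "(0, 0) \<in> H"
    unfolding friedrichs_iff
    using subspace_0[OF subspace_grad_graph] by (intro exI[of _ 0]) (simp add: zero_prod_def)
  then show "0 \<in> H" by (simp add: zero_prod_def)
next
  fix p q assume "p \<in> H" "q \<in> H"
  then obtain u w u' w' where p: "p = (u, w)" "q = (u', w')" and h: "(u, w) \<in> H" "(u', w') \<in> H"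
    by (metis surj_pair)
  then obtain U U' where "(u, U) \<in> grad_graph" "\<forall>v V. (v, V) \<in> grad_graph \<longrightarrow> inner U V = inner w v"
    "(u', U') \<in> grad_graph" "\<forall>v V. (v, V) \<in> grad_graph \<longrightarrow> inner U' V = inner w' v"
    unfolding friedrichs_iff by blast
  then show "p + q \<in> H"
    using subspace_add[OF subspace_grad_graph, of "(u, U)" "(u', U')"]
    by (auto simp: p friedrichs_iff inner_add_left intro!: exI[of _ "U + U'"])
next
  fix p and r :: real assume "p \<in> H"
  then obtain u w where p: "p = (u, w)" and h: "(u, w) \<in> H" by (metis surj_pair)
  then obtain U where "(u, U) \<in> grad_graph" "\<forall>v V. (v, V) \<in> grad_graph \<longrightarrow> inner U V = inner w v"
    unfolding friedrichs_iff by blast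
  then show "r *\<^sub>R p \<in> H"
    using subspace_scale[OF subspace_grad_graph, of "(u, U)" r]
    by (auto simp: p friedrichs_iff intro!: exI[of _ "r *\<^sub>R U"])
qed

lemma friedrichs_nonneg: "(u, w) \<in> H \<Longrightarrow> 0 \<le> inner w u"
  unfolding friedrichs_iff by (metis inner_ge_zero)

lemma friedrichs_symmetric: "(u, w) \<in> H \<Longrightarrow> (u', w') \<in> H \<Longrightarrow> inner w u' = inner u w'"
  unfolding friedrichs_iff by (metis inner_commute)

lemma friedrichs_scaleC:
  assumes "(u, w) \<in> H"
  shows "(scaleC z u, scaleC z w) \<in> H"
proof -
  obtain U where U: "(u, U) \<in> grad_graph" and eq: "\<And>v V. (v, V) \<in> grad_graph \<Longrightarrow> inner U V = inner w v"
    using assms unfolding friedrichs_iff by blast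
  have adj: "inner (scaleC z w) v = inner w (scaleC (cnj z) v)" for z :: complex and w v :: "(real^'n) l2"
    by (simp add: inner_l2_def cinner_scaleC_left cinner_scaleC_right)
  then have adjv: "inner (scaleC_vec z W) V = inner W (scaleC_vec (cnj z) V)" for W V :: "(real^'n) l2^'n"
    by (simp add: inner_vec_def scaleC_vec_def)
  show ?thesis
    unfolding friedrichs_iff
    using grad_graph_scaleC[OF U, of z] eq[OF grad_graph_scaleC] by (auto simp: adj adjv)
qed

section \<open>The resolvent\<close>

text \<open>The weak equation \<open>inner U V + \<alpha> * inner u v = inner g v\<close> says that \<open>(g / \<surd>\<alpha>, 0) - (\<surd>\<alpha> u, U)\<close> is
orthogonal to the closed subspace of all \<open>(\<surd>\<alpha> v, V)\<close> with \<open>(v, V)\<close> in the graph of the gradient.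
The solution is read off from the projection onto this subspace.\<close>

lemma friedrichs_solution_exists:
  assumes "0 < \<alpha>"
  shows "\<exists>u. (u, g - \<alpha> *\<^sub>R u) \<in> H"
proof -
  define s where "s = sqrt \<alpha>"
  have s: "s > 0" "s * s = \<alpha>" using assms by (auto simp: s_def)
  define T where "T p = (fst p /\<^sub>R s, snd p)" for p :: "(real^'n) l2 \<times> ((real^'n) l2^'n)"
  have T: "bounded_linear T"
    unfolding T_def
    by (intro bounded_linear_Pair bounded_linear_scaleR_right[THEN bounded_linear_compose]
        bounded_linear_fst bounded_linear_snd)
  have "closed (T -` grad_graph)"
    by (intro closed_vimage closed_grad_graph linear_continuous_on T)
  moreover have "subspace (T -` grad_graph)"
    using linear_subspace_vimage[OF bounded_linear.linear[OF T] subspace_grad_graph] .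
  ultimately have "\<exists>p\<in>T -` grad_graph. \<forall>y\<in>T -` grad_graph. inner ((g /\<^sub>R s, 0) - p) y = 0"
    by (intro closed_subspace_projection)
  then obtain p where p: "T p \<in> grad_graph"
      "\<And>y. T y \<in> grad_graph \<Longrightarrow> inner ((g /\<^sub>R s, 0) - p) y = 0"
    by blast
  define u U where "u = fst p /\<^sub>R s" and "U = snd p"
  have uU: "(u, U) \<in> grad_graph" using p(1) by (simp add: T_def u_def U_def)
  have pe: "p = (s *\<^sub>R u, U)" using s by (simp add: u_def U_def prod_eq_iff)
  have "inner U V = inner (g - \<alpha> *\<^sub>R u) v" if "(v, V) \<in> grad_graph" for v V
  proof -
    have "T (s *\<^sub>R v, V) \<in> grad_graph" using that s by (simp add: T_def)
    moreover have "s * (inverse s * t - s * r) = t - \<alpha> * r" for t r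
      unfolding s(2)[symmetric] using s(1) by (simp add: field_simps)
    ultimately show ?thesis
      using p(2)[of "(s *\<^sub>R v, V)"]
      by (simp add: pe inner_simps)
  qed
  with uU show ?thesis unfolding friedrichs_iff by blast
qed

lemma friedrichs_resolvent_bound:
  assumes "0 < \<alpha>" "(u, g - \<alpha> *\<^sub>R u) \<in> H"
  shows "norm u \<le> norm g / \<alpha>"
proof (cases "u = 0")
  case False
  have "\<alpha> * (norm u)\<^sup>2 \<le> inner g u"
    using friedrichs_nonneg[OF assms(2)] by (simp add: inner_simps power2_norm_eq_inner)
  also have "\<dots> \<le> norm g * norm u" by (rule norm_cauchy_schwarz)
  finally have "(\<alpha> * norm u) * norm u \<le> norm g * norm u" by (simp add: power2_eq_square)
  then have "\<alpha> * norm u \<le> norm g" using False by (simp add: mult_le_cancel_right)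
  then show ?thesis using assms(1) by (simp add: field_simps)
qed (use assms in auto)

lemma friedrichs_solution_unique:
  assumes "0 < \<alpha>" "(u, g - \<alpha> *\<^sub>R u) \<in> H" "(v, g - \<alpha> *\<^sub>R v) \<in> H"
  shows "u = v"
proof -
  have "(u - v, 0 - \<alpha> *\<^sub>R (u - v)) \<in> H"
    using subspace_diff[OF subspace_friedrichs assms(2,3)] by (simp add: algebra_simps)
  from friedrichs_resolvent_bound[OF assms(1) this] show ?thesis by simp
qed

lemma is_resolvent_friedrichs_exists:
  assumes \<alpha>: "0 < \<alpha>"
  shows "\<exists>R. is_resolvent H (- complex_of_real \<alpha>) R"
proof -
  obtain R where R: "\<And>g. (R g, g - \<alpha> *\<^sub>R R g) \<in> H"
    using friedrichs_solution_exists[OF \<alpha>] by metis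
  have Req: "R g = u" if "(u, g - \<alpha> *\<^sub>R u) \<in> H" for g u
    using friedrichs_solution_unique[OF \<alpha> R that] .
  have "R (g + h) = R g + R h" for g h
    using subspace_add[OF subspace_friedrichs R[of g] R[of h]]
    by (intro Req) (simp add: algebra_simps)
  moreover have C: "R (scaleC z g) = scaleC z (R g)" for z g
  proof (rule Req)
    have "scaleC z (g - \<alpha> *\<^sub>R R g) = scaleC z g - \<alpha> *\<^sub>R scaleC z (R g)"
      by (simp only: linear_diff[OF bounded_linear.linear[OF bounded_linear_scaleC]]
          linear_scale[OF bounded_linear.linear[OF bounded_linear_scaleC]])
    then show "(scaleC z (R g), scaleC z g - \<alpha> *\<^sub>R scaleC z (R g)) \<in> H"
      using friedrichs_scaleC[OF R[of g], of z] by simp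
  qed
  moreover have "norm (R g) \<le> norm g * (1 / \<alpha>)" for g
    using friedrichs_resolvent_bound[OF \<alpha> R[of g]] by simp
  ultimately have "bounded_clinear R"
    unfolding bounded_clinear_def
    by (auto intro!: bounded_linear_intro[where K = "1 / \<alpha>"] simp: scaleR_l2_def)
  moreover have "(shift_graph H (- complex_of_real \<alpha>))\<inverse> = {(g, R g) |g. True}"
  proof (intro set_eqI iffI)
    fix x assume "x \<in> (shift_graph H (- complex_of_real \<alpha>))\<inverse>"
    then obtain u h where x: "x = (h - scaleC (- complex_of_real \<alpha>) u, u)" and h: "(u, h) \<in> H"
      by (auto simp: shift_graph_def)
    have "h - scaleC (- complex_of_real \<alpha>) u = h + \<alpha> *\<^sub>R u"
      using scaleC_of_real[of "- \<alpha>" u] by simp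
    then have "x = (h + \<alpha> *\<^sub>R u, u)" using x by (simp only:)
    then show "x \<in> {(g, R g) |g. True}"
      using h Req[of u "h + \<alpha> *\<^sub>R u"] by simp
  next
    fix x assume "x \<in> {(g, R g) |g. True}"
    then obtain g where x: "x = (g, R g)" by blast
    have "g = (g - \<alpha> *\<^sub>R R g) - scaleC (- complex_of_real \<alpha>) (R g)"
      using scaleC_of_real[of "- \<alpha>" "R g"] by simp
    then show "x \<in> (shift_graph H (- complex_of_real \<alpha>))\<inverse>"
      using R[of g] unfolding x shift_graph_def by blast
  qed
  ultimately show ?thesis by (auto simp: is_resolvent_def)
qed

lemma not_in_spectrum: "0 < \<alpha> \<Longrightarrow> - complex_of_real \<alpha> \<notin> spectrum H"
  using is_resolvent_friedrichs_exists by (auto simp: spectrum_def)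

lemma bounded_clinear_resolvent:
  "0 < \<alpha> \<Longrightarrow> bounded_clinear (resolvent H (- complex_of_real \<alpha>))"
  using is_resolvent_resolvent[OF not_in_spectrum] by (auto simp: is_resolvent_def)

lemma resolvent_solves:
  assumes "0 < \<alpha>"
  defines "A \<equiv> resolvent H (- complex_of_real \<alpha>)"
  shows "(A g, g - \<alpha> *\<^sub>R A g) \<in> H"
proof -
  have "(g, A g) \<in> (shift_graph H (- complex_of_real \<alpha>))\<inverse>"
    using is_resolvent_resolvent[OF not_in_spectrum[OF assms(1)]] unfolding is_resolvent_def A_def by blast
  then obtain h where h: "(A g, h) \<in> H" "g = h - scaleC (- complex_of_real \<alpha>) (A g)"
    by (auto simp: shift_graph_def)
  have "h - scaleC (- complex_of_real \<alpha>) (A g) = h + \<alpha> *\<^sub>R A g"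
    using scaleC_of_real[of "- \<alpha>" "A g"] by simp
  with h show ?thesis by (metis add_diff_cancel_right')
qed

text \<open>Both parts follow from solvability of \<open>H u + u = g\<close> for every \<open>g\<close>. If \<open>g\<close> is orthogonal to the
domain, then positivity forces the solution to be \<open>0\<close>, hence \<open>g = H 0\<close>, and such a \<open>g\<close> is
orthogonal to the test functions. If \<open>(v, w)\<close> is in the adjoint graph, let \<open>v'\<close> solve
\<open>H v' + v' = w + v\<close>; then \<open>v - v'\<close> is orthogonal to the range of \<open>H + 1\<close>, so it vanishes.\<close>

lemma self_adjoint_friedrichs: "self_adjoint H"
  unfolding self_adjoint_def
proof
  show "closure (Domain H) = UNIV"
  proof (rule closure_subspace_eq_UNIV)
    have "Domain H = fst ` H" by force
    then show "subspace (Domain H)"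
      using linear_subspace_image[OF linear_fst subspace_friedrichs] by simp
  next
    fix g assume orth: "\<And>y. y \<in> Domain H \<Longrightarrow> inner g y = 0"
    obtain u where u: "(u, g - 1 *\<^sub>R u) \<in> H" using friedrichs_solution_exists[of 1 g] by auto
    have "inner (g - 1 *\<^sub>R u) u = - (norm u)\<^sup>2"
      using orth[OF DomainI[OF u]] by (simp add: inner_simps power2_norm_eq_inner)
    with friedrichs_nonneg[OF u] have "u = 0" by simp
    with u have "(0, g) \<in> H" by simp
    then obtain U where U: "(0, U) \<in> grad_graph" "\<forall>v V. (v, V) \<in> grad_graph \<longrightarrow> inner U V = inner g v"
      unfolding friedrichs_iff by blast
    then have g0: "inner g v = 0" if "(v, V) \<in> grad_graph" for v V
      using grad_graph_closable[OF U(1)] that by fastforce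
    show "g = 0"
    proof (rule l2_eq_0_if_orthogonal_test_functions)
      fix \<phi> :: "real^'n \<Rightarrow> complex" assume "\<phi> \<in> test_functions"
      then have "(abs_l2 \<phi>, grad \<phi>) \<in> grad_graph"
        using closure_subset[of test_graph] by (auto simp: grad_graph_def test_graph_def)
      from g0[OF this] g0[OF grad_graph_scaleC[OF this, of \<i>]]
      show "cinner g (abs_l2 \<phi>) = 0" by (simp add: cinner_eq_inner complex_eq_iff)
    qed
  qed
  show "adjoint_graph H = H"
  proof (intro set_eqI iffI)
    fix p assume "p \<in> H"
    then obtain v w where p: "p = (v, w)" "(v, w) \<in> H" by (metis surj_pair)
    have "cinner h v = cinner u w" if "(u, h) \<in> H" for u h
      using friedrichs_symmetric[OF that p(2)] friedrichs_symmetric[OF that friedrichs_scaleC[OF p(2), of \<i>]]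
      by (simp add: cinner_eq_inner)
    with p show "p \<in> adjoint_graph H" by (auto simp: adjoint_graph_def)
  next
    fix p assume "p \<in> adjoint_graph H"
    moreover obtain v w where p: "p = (v, w)" by (cases p)
    ultimately have adj: "inner h v = inner u w" if "(u, h) \<in> H" for u h
      using that by (fastforce simp: adjoint_graph_def inner_l2_def)
    obtain v' where v': "(v', (w + v) - 1 *\<^sub>R v') \<in> H"
      using friedrichs_solution_exists[of 1 "w + v"] by auto
    obtain u where u: "(u, (v - v') - 1 *\<^sub>R u) \<in> H"
      using friedrichs_solution_exists[of 1 "v - v'"] by auto
    have "inner (v - v') (v - v') = 0"
      using adj[OF u] friedrichs_symmetric[OF u v'] by (simp add: inner_simps inner_commute)
    then have "v' = v" by simp
    with v' show "p \<in> H" by (simp add: p)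
  qed
qed

section \<open>Modulated resolvents\<close>

text \<open>The closed gradient of \<open>mod_op k u\<close> when \<open>U\<close> is that of \<open>u\<close>, by \<open>grad_graph_mod_op\<close>.\<close>

definition twisted_grad :: "real^'n \<Rightarrow> (real^'n) l2 \<Rightarrow> (real^'n) l2^'n \<Rightarrow> (real^'n) l2^'n" where
  "twisted_grad k u U = (\<chi> i. mod_op k (U $ i) + scaleC (\<i> * complex_of_real (k $ i)) (M (mod_op k u)))"

text \<open>A bound for the relative error between the form with parameter \<open>\<alpha>\<close> and its modulation by \<open>k\<close>, linear in
\<open>\<bar>k\<bar>\<close> near \<open>0\<close>.\<close>

definition defect :: "real \<Rightarrow> real^'n \<Rightarrow> real" where
  "defect \<alpha> k = norm k + ((norm k)\<^sup>2 + norm k) * c / \<alpha>"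

text \<open>The zeroth-order term has norm at most \<open>\<bar>k\<bar> \<surd>c \<bar>u\<bar>\<close>. In the square of the sum the cross term
carries one factor \<open>\<bar>k\<bar>\<close>, which is split evenly over \<open>\<bar>U\<bar>\<^sup>2\<close> and \<open>c \<bar>u\<bar>\<^sup>2\<close>.\<close>

lemma twisted_form_bound:
  assumes "0 < \<alpha>"
  shows "(norm (twisted_grad k u U))\<^sup>2 + \<alpha> * (norm u)\<^sup>2 \<le> (1 + defect \<alpha> k) * ((norm U)\<^sup>2 + \<alpha> * (norm u)\<^sup>2)"
proof -
  define V where "V = (\<chi> i. mod_op k (U $ i))"
  define W where "W = (\<chi> i. scaleC (\<i> * complex_of_real (k $ i)) (M (mod_op k u)))"
  let ?\<kappa> = "norm k" and ?p = "norm U" and ?s = "sqrt c * norm u"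
  have split: "twisted_grad k u U = V + W" by (simp add: twisted_grad_def V_def W_def vec_eq_iff)
  have V: "norm V = ?p"
    by (simp add: V_def norm_vec_def norm_mod_op)
  have "norm (M (mod_op k u)) \<le> ?s"
    using norm_mult_l2_le[OF bounded_borel_root_a norm_root_a_le, of "mod_op k u"] c_nonneg
    by (simp add: norm_mod_op)
  moreover have "norm W = ?\<kappa> * norm (M (mod_op k u))"
  proof (rule power2_eq_imp_eq)
    show "(norm W)\<^sup>2 = (?\<kappa> * norm (M (mod_op k u)))\<^sup>2"
      by (simp add: W_def norm_vec_squared norm_scaleC norm_mult power_mult_distrib sum_distrib_right)
  qed auto
  ultimately have W: "norm W \<le> ?\<kappa> * ?s" by (simp add: mult_left_mono)
  have "(norm (V + W))\<^sup>2 \<le> (?p + ?\<kappa> * ?s)\<^sup>2"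
    using norm_triangle_ineq[of V W] V W by (intro power_mono) auto
  also have "\<dots> = ?p\<^sup>2 + ?\<kappa> * (2 * ?p * ?s) + ?\<kappa>\<^sup>2 * ?s\<^sup>2"
    by (simp add: power2_eq_square algebra_simps)
  also have "\<dots> \<le> ?p\<^sup>2 + ?\<kappa> * (?p\<^sup>2 + ?s\<^sup>2) + ?\<kappa>\<^sup>2 * ?s\<^sup>2"
    using sum_squares_bound[of ?p ?s] by (intro add_mono mult_left_mono) auto
  also have "\<dots> = (1 + ?\<kappa>) * ?p\<^sup>2 + (?\<kappa>\<^sup>2 + ?\<kappa>) * c * (norm u)\<^sup>2"
    using c_nonneg by (simp add: power_mult_distrib algebra_simps)
  finally have "(norm (twisted_grad k u U))\<^sup>2 + \<alpha> * (norm u)\<^sup>2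
      \<le> (1 + ?\<kappa>) * ?p\<^sup>2 + ((?\<kappa>\<^sup>2 + ?\<kappa>) * c + \<alpha>) * (norm u)\<^sup>2"
    by (simp add: split algebra_simps)
  also have "\<dots> \<le> (1 + defect \<alpha> k) * ?p\<^sup>2 + (1 + defect \<alpha> k) * \<alpha> * (norm u)\<^sup>2"
  proof (rule add_mono; rule mult_right_mono)
    show "1 + ?\<kappa> \<le> 1 + defect \<alpha> k"
      using assms c_nonneg by (simp add: defect_def)
    have "(1 + defect \<alpha> k) * \<alpha> = \<alpha> + ?\<kappa> * \<alpha> + (?\<kappa>\<^sup>2 + ?\<kappa>) * c"
      using assms by (simp add: defect_def field_simps)
    then show "(?\<kappa>\<^sup>2 + ?\<kappa>) * c + \<alpha> \<le> (1 + defect \<alpha> k) * \<alpha>"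
      using assms by simp
  qed auto
  finally show ?thesis by (simp add: algebra_simps)
qed

lemma defect_nonneg: "0 < \<alpha> \<Longrightarrow> 0 \<le> defect \<alpha> k"
  using c_nonneg by (simp add: defect_def)

text \<open>Let \<open>q\<close> be the form \<open>\<bar>U\<bar>\<^sup>2 + \<alpha> \<bar>u\<bar>\<^sup>2\<close> and let \<open>q'\<close> be its conjugate by the plane wave. Then
\<open>u = A g\<close> and \<open>u' = V\<^sub>k A V\<^sub>-\<^sub>k g\<close> represent the functional \<open>inner g\<close> for \<open>q\<close> and \<open>q'\<close>, with values
\<open>m = q(u) = inner g u\<close> and \<open>m' = q'(u') = inner g u'\<close>. Since \<open>u'\<close> lies in the common form domain,
\<open>q(u' - u) = q(u') - 2 m' + m\<close>, and the comparison of \<open>q\<close> with \<open>q'\<close> in both directions bounds the right-hand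
side by \<open>2 \<delta> m'\<close>.\<close>

lemma resolvent_mod_op_bound:
  assumes \<alpha>: "0 < \<alpha>"
  defines "A \<equiv> resolvent H (- complex_of_real \<alpha>)"
  shows "norm (mod_op k (A (mod_op (- k) g)) - A g) \<le> sqrt (2 * defect \<alpha> k) / \<alpha> * norm g"
proof -
  define \<delta> where "\<delta> = defect \<alpha> k"
  have \<delta>: "0 \<le> \<delta>" using defect_nonneg[OF \<alpha>] by (simp add: \<delta>_def)
  have \<delta>': "defect \<alpha> (- k) = \<delta>" by (simp add: \<delta>_def defect_def)
  define q where "q u U = (norm U)\<^sup>2 + \<alpha> * (norm u)\<^sup>2" for u :: "(real^'n) l2" and U :: "(real^'n) l2^'n"
  define b where "b u U v V = inner U V + \<alpha> * inner u v" for u v :: "(real^'n) l2" and U V :: "(real^'n) l2^'n"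
  have q_diff: "q (r *\<^sub>R u - v) (r *\<^sub>R U - V) = r\<^sup>2 * q u U - 2 * r * b v V u U + q v V" for r u v U V
    unfolding q_def b_def power2_norm_eq_inner
    by (simp add: inner_simps inner_commute power2_eq_square algebra_simps)
  have sol: "\<exists>U. (A g, U) \<in> grad_graph \<and> (\<forall>v V. (v, V) \<in> grad_graph \<longrightarrow> b (A g) U v V = inner g v)" for g
    using resolvent_solves[OF \<alpha>, of g] unfolding friedrichs_iff A_def[symmetric]
    by (fastforce simp: b_def inner_simps)
  define g' y u u' where "g' = mod_op (- k) g" and "y = A g'" and "u = A g" and "u' = mod_op k y"
  obtain U where U: "(u, U) \<in> grad_graph" "\<And>v V. (v, V) \<in> grad_graph \<Longrightarrow> b u U v V = inner g v"
    using sol[of g] by (auto simp: u_def)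
  obtain Y where Y: "(y, Y) \<in> grad_graph" "\<And>v V. (v, V) \<in> grad_graph \<Longrightarrow> b y Y v V = inner g' v"
    using sol[of g'] by (auto simp: y_def)
  define U' where "U' = twisted_grad k y Y"
  define Z where "Z = twisted_grad (- k) u U"
  have U': "(u', U') \<in> grad_graph"
    using grad_graph_mod_op[OF Y(1), of k] by (simp add: u'_def U'_def twisted_grad_def)
  have Z: "(mod_op (- k) u, Z) \<in> grad_graph"
    using grad_graph_mod_op[OF U(1), of "- k"] by (simp add: Z_def twisted_grad_def)
  define m m' where "m = inner g u" and "m' = inner g' y"
  have q_self: "q v V = b v V v V" for v V by (simp add: q_def b_def power2_norm_eq_inner)
  have isom: "inner (mod_op l v) (mod_op l w) = inner v w" for l v w
    by (simp add: inner_l2_def mod_op_isometry)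
  have qu: "q u U = m" and qy: "q y Y = m'"
    using U Y by (simp_all add: q_self m_def m'_def)
  have "inner g u' = inner (mod_op k g') (mod_op k y)"
    by (simp add: g'_def u'_def mod_op_inverse)
  then have gu': "inner g u' = m'" by (simp add: isom m'_def)
  have qu': "q u' U' \<le> (1 + \<delta>) * m'"
    using twisted_form_bound[OF \<alpha>, of k y Y] qy by (simp add: q_def U'_def u'_def norm_mod_op \<delta>_def)
  have qZ: "q (mod_op (- k) u) Z \<le> (1 + \<delta>) * m"
    using twisted_form_bound[OF \<alpha>, of "- k" u U] qu by (simp add: q_def Z_def norm_mod_op \<delta>')
  have mm': "m \<le> (1 + \<delta>) * m'"
  proof -
    \<comment> \<open>Positivity of \<open>q'\<close> on \<open>t u - u'\<close>, transported back by the plane wave; this \<open>t\<close> is optimal for the bound \<open>(1 + \<delta>) m\<close>.\<close>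
    let ?t = "1 / (1 + \<delta>)"
    have "0 \<le> q (?t *\<^sub>R mod_op (- k) u - y) (?t *\<^sub>R Z - Y)"
      using \<alpha> by (simp add: q_def)
    also have "\<dots> = ?t\<^sup>2 * q (mod_op (- k) u) Z - 2 * ?t * m + m'"
      using Y(2)[OF Z] unfolding q_diff qy by (simp add: g'_def isom m_def)
    also have "\<dots> \<le> ?t\<^sup>2 * ((1 + \<delta>) * m) - 2 * ?t * m + m'"
      using qZ by (intro add_right_mono diff_right_mono mult_left_mono) auto
    also have "\<dots> = m' - m / (1 + \<delta>)"
    proof -
      have "?t\<^sup>2 * ((1 + \<delta>) * m) = ?t * m" using \<delta> by (simp add: power2_eq_square)
      then show ?thesis by simp
    qed
    finally show ?thesis using \<delta> by (simp add: field_simps)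
  qed
  have m'_le: "m' \<le> (norm g)\<^sup>2 / \<alpha>"
  proof -
    have "norm y \<le> norm g' / \<alpha>"
      using friedrichs_resolvent_bound[OF \<alpha> resolvent_solves[OF \<alpha>]] by (simp add: y_def A_def)
    then have "norm g' * norm y \<le> norm g' * (norm g' / \<alpha>)" by (intro mult_left_mono) auto
    with norm_cauchy_schwarz[of g' y] show ?thesis
      by (simp add: m'_def g'_def norm_mod_op power2_eq_square)
  qed
  have "\<alpha> * (norm (u' - u))\<^sup>2 \<le> q (1 *\<^sub>R u' - u) (1 *\<^sub>R U' - U)" by (simp add: q_def)
  also have "\<dots> = q u' U' - 2 * m' + m"
    using U(2)[OF U'] unfolding q_diff qu by (simp add: gu')
  also have "\<dots> \<le> 2 * \<delta> * m'" using qu' mm' by (simp add: algebra_simps)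
  also have "\<dots> \<le> 2 * \<delta> * ((norm g)\<^sup>2 / \<alpha>)"
    using m'_le \<delta> by (intro mult_left_mono) auto
  finally have "(norm (u' - u))\<^sup>2 \<le> 2 * \<delta> * ((norm g)\<^sup>2 / \<alpha>) / \<alpha>"
    using \<alpha> by (simp add: field_simps)
  also have "\<dots> = (sqrt (2 * \<delta>) / \<alpha> * norm g)\<^sup>2"
    using \<delta> by (simp add: power_mult_distrib power_divide power2_eq_square)
  finally show ?thesis
    using \<delta> \<alpha> by (simp add: power2_le_iff_abs_le u'_def u_def y_def g'_def \<delta>_def)
qed

lemma resolvent_tendsto:
  assumes \<alpha>: "0 < \<alpha>"
  defines "A \<equiv> resolvent H (- complex_of_real \<alpha>)"
  shows "((\<lambda>k. onorm (\<lambda>u. mod_op k (A (mod_op (- k) u)) - A u)) \<longlongrightarrow> 0) (at 0)"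
proof (rule tendsto_sandwich[OF _ _ tendsto_const])
  have A: "bounded_linear A"
    using bounded_clinear_resolvent[OF \<alpha>] by (simp add: bounded_clinear_def A_def)
  have "bounded_linear (\<lambda>u. mod_op k (A (mod_op (- k) u)) - A u)" for k
    by (intro bounded_linear_sub A bounded_linear_compose[OF bounded_linear_mod_op]
        bounded_linear_compose[OF A bounded_linear_mod_op])
  then show "\<forall>\<^sub>F k in at 0. 0 \<le> onorm (\<lambda>u. mod_op k (A (mod_op (- k) u)) - A u)"
    by (intro always_eventually allI onorm_pos_le)
  show "\<forall>\<^sub>F k in at 0. onorm (\<lambda>u. mod_op k (A (mod_op (- k) u)) - A u) \<le> sqrt (2 * defect \<alpha> k) / \<alpha>"
    using resolvent_mod_op_bound[OF \<alpha>] defect_nonneg[OF \<alpha>] \<alpha>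
    by (intro always_eventually allI onorm_bound) (auto simp: A_def)
  have "((\<lambda>k. sqrt (2 * defect \<alpha> k) / \<alpha>) \<longlongrightarrow> sqrt (2 * (norm (0::real^'n) + ((norm (0::real^'n))\<^sup>2 + norm (0::real^'n)) * c / \<alpha>)) / \<alpha>) (at 0)"
    unfolding defect_def using \<alpha> by (intro tendsto_intros) auto
  then show "((\<lambda>k. sqrt (2 * defect \<alpha> k) / \<alpha>) \<longlongrightarrow> 0) (at 0)" by simp
qed

end

theorem theorem1:
  fixes a :: "real ^ 'n \<Rightarrow> real"
  assumes "\<forall>x. 0 < a x"
    and "C_k 1 a"
    and "\<exists>c>0. \<forall>x. 0 < a x \<and> a x \<le> c"
  shows "(\<forall>\<alpha>>0. - complex_of_real \<alpha> \<notin> spectrum (friedrichs a) \<and>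
            (let A = resolvent (friedrichs a) (- complex_of_real \<alpha>) in
              ((\<lambda>k. onorm (\<lambda>u. mod_op k (A (mod_op (- k) u)) - A u)) \<longlongrightarrow> 0) (at 0))) \<and>
         affiliated (friedrichs a) \<D>"
proof -
  obtain c where "\<And>x. 0 < a x" "\<And>x. a x \<le> c" using assms(3) by blast
  then interpret elliptic_coefficient a c using assms(2) by unfold_locales
  have "affiliated (friedrichs a) \<D>"
    unfolding affiliated_def
  proof (intro conjI exI)
    show "- complex_of_real 1 \<notin> spectrum (friedrichs a)" by (rule not_in_spectrum) simp
    show "resolvent (friedrichs a) (- complex_of_real 1) \<in> \<D>"
      unfolding \<D>_def using bounded_clinear_resolvent[of 1] resolvent_tendsto[of 1] by simp
  qed (rule self_adjoint_friedrichs)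
  then show ?thesis
    unfolding Let_def using not_in_spectrum resolvent_tendsto by blast
qed

end
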